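(* $\operatorname{scf}(\operatorname{Aut}(\mathbb{Q},\leq))>\aleph_0$, and so $\operatorname{cf}(\operatorname{Aut}(\mathbb{Q},\leq))>\aleph_0$ and $\operatorname{Aut}(\mathbb{Q},\leq)$ has Bergman's property.
   Context: $\operatorname{Aut}(\mathbb{Q},\leq)$ is the group of all order-preserving bijections of $\mathbb{Q}$. The cofinality $\operatorname{cf}(G)$ of a group $G$ is the least cardinal $\lambda$ such that $G$ can be written as the union of a chain of $\lambda$ proper subgroups. The strong cofinality $\operatorname{scf}(G)$ is the least cardinal $\lambda$ such that $G$ can be written as the union of a chain $(H_i)_{i<\lambda}$ (with $H_i\subseteq H_j$ whenever $i\leq j$) of $\lambda$ proper subsets $H_i$ such that for all $i$: $H_i=H_i^{-1}$, and there exists $j\geq i$ with $H_iH_i\subseteq H_j$. A group $G$ has Bergman's property if for every generating set $X$ of $G$ with $X=X^{-1}$ and $1\in X$ there is $N\in\mathbb{N}$ such that $G=X^N$, where $X^N$ is the set of all products of $N$ elements of $X$. *)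

theory Defs
  imports Complex_Main "HOL-Algebra.Generated_Groups"
begin

unbundle cardinal_syntax

definition Aut_Q :: "(rat \<Rightarrow> rat) monoid" where
  "Aut_Q = \<lparr>carrier = {f. bij f \<and> mono f}, monoid.mult = (\<circ>), one = id\<rparr>"

lemma group_Aut_Q: "group Aut_Q"
proof (rule groupI)
  fix f assume "f \<in> carrier Aut_Q"
  then have f: "bij f" "mono f" by (auto simp: Aut_Q_def)
  have "mono (inv_into UNIV f)"
  proof (rule monoI)
    fix x y :: rat assume "x \<le> y"
    show "inv_into UNIV f x \<le> inv_into UNIV f y"
    proof (rule ccontr)
      assume "\<not> inv_into UNIV f x \<le> inv_into UNIV f y"
      then have "f (inv_into UNIV f y) \<le> f (inv_into UNIV f x)" using f(2) by (simp add: monoD)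
      then have "x = y" using \<open>x \<le> y\<close> f(1) by (simp add: bij_is_surj surj_f_inv_f)
      with \<open>\<not> inv_into UNIV f x \<le> inv_into UNIV f y\<close> show False by simp
    qed
  qed
  moreover have "bij (inv_into UNIV f)" using f(1) by (rule bij_imp_bij_inv)
  moreover have "inv_into UNIV f \<circ> f = id" using f(1) by (simp add: bij_is_inj)
  ultimately show "\<exists>g\<in>carrier Aut_Q. g \<otimes>\<^bsub>Aut_Q\<^esub> f = \<one>\<^bsub>Aut_Q\<^esub>"
    by (auto simp: Aut_Q_def)
qed (auto simp: Aut_Q_def bij_comp mono_def o_assoc)

text \<open>
  A cardinal \<open>\<lambda>\<close> is represented by a cardinal order \<open>r\<close>, i.e. a well-order that is minimal
  among the well-orders of its field; the ordinals \<open>i < \<lambda>\<close> are the elements of \<open>Field r\<close>,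
  and \<open>i \<le> j\<close> is \<open>(i, j) \<in> r\<close>.
\<close>

definition chain_union :: "('a, 'm) monoid_scheme \<Rightarrow> 'i rel \<Rightarrow> ('i \<Rightarrow> 'a set) \<Rightarrow> bool" where
  "chain_union G r H \<longleftrightarrow>
     (\<forall>i j. (i, j) \<in> r \<longrightarrow> H i \<subseteq> H j) \<and> (\<Union>i\<in>Field r. H i) = carrier G"

definition cf_witness :: "('a, 'm) monoid_scheme \<Rightarrow> 'i rel \<Rightarrow> bool" where
  "cf_witness G r \<longleftrightarrow> (\<exists>H. chain_union G r H \<and>
     (\<forall>i\<in>Field r. subgroup (H i) G \<and> H i \<noteq> carrier G))"

definition scf_witness :: "('a, 'm) monoid_scheme \<Rightarrow> 'i rel \<Rightarrow> bool" where
  "scf_witness G r \<longleftrightarrow> (\<exists>H. chain_union G r H \<and>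
     (\<forall>i\<in>Field r. H i \<subset> carrier G \<and> H i = set_inv\<^bsub>G\<^esub> (H i) \<and>
        (\<exists>j\<in>Field r. (i, j) \<in> r \<and> H i <#>\<^bsub>G\<^esub> H i \<subseteq> H j)))"

text \<open>
  The least cardinal (unique up to \<open>=o\<close>) with property \<open>P\<close>; unspecified if there is none.
\<close>

definition least_cardinal :: "('i rel \<Rightarrow> bool) \<Rightarrow> 'i rel" where
  "least_cardinal P =
     (SOME r. Card_order r \<and> P r \<and> (\<forall>r'. Card_order r' \<and> P r' \<longrightarrow> r \<le>o r'))"

text \<open>
  It suffices to consider cardinals on the element type of \<open>G\<close>, i.e. of size at most that
  of the type: a chain of any length with the required properties has a cofinal subchain which is
  strictly increasing, has the same properties, and is indexed by a regular cardinal \<open>\<mu>\<close>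
  not above the original length; choosing a new element of \<open>G\<close> at each successor step shows
  \<open>\<mu> \<le> |G|\<close>. For an uncountable group both cardinals exist: well-order \<open>G\<close> in type
  \<open>|G|\<close> and take the subgroups generated by the initial segments.
\<close>

definition cf :: "('a, 'm) monoid_scheme \<Rightarrow> 'a rel" where
  "cf G = least_cardinal (cf_witness G)"

definition scf :: "('a, 'm) monoid_scheme \<Rightarrow> 'a rel" where
  "scf G = least_cardinal (scf_witness G)"

primrec set_power :: "('a, 'm) monoid_scheme \<Rightarrow> 'a set \<Rightarrow> nat \<Rightarrow> 'a set" where
  "set_power G X 0 = {\<one>\<^bsub>G\<^esub>}"
| "set_power G X (Suc n) = set_power G X n <#>\<^bsub>G\<^esub> X"

definition Bergman_property :: "('a, 'm) monoid_scheme \<Rightarrow> bool" where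
  "Bergman_property G \<longleftrightarrow>
     (\<forall>X. X \<subseteq> carrier G \<and> generate G X = carrier G \<and> X = set_inv\<^bsub>G\<^esub> X \<and> \<one>\<^bsub>G\<^esub> \<in> X \<longrightarrow>
        (\<exists>N. carrier G = set_power G X N))"

end

theory Submission
  imports Defs
begin

text \<open>
  Let \<open>G = \<Union>\<^sub>n H\<^sub>n\<close> be a countable chain with \<open>H\<^sub>n = H\<^sub>n\<^sup>-\<^sup>1\<close> and \<open>H\<^sub>n H\<^sub>n \<subseteq> H\<^sub>n\<^sub>+\<^sub>1\<close>.  A diagonal argument over
  disjoint sets \<open>S\<^sub>n\<close> gives an \<open>n\<close> for which each \<open>g\<close> supported on \<open>S\<^sub>n\<close> agrees on \<open>S\<^sub>n\<close> with an
  element of \<open>H\<^sub>n\<close>.  Taking commutators with a fixed shift inside \<open>S\<^sub>n\<close> puts all automorphisms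
  supported on a union of intervals \<open>[8q, 8q + 4)\<close>, and then the pointwise stabilizer of any
  translate of \<open>4\<int>\<close>, into a single \<open>H\<^sub>k\<close>.  Two such stabilizers multiply to a set containing every
  \<open>g\<close> with \<open>i \<le> g i < i + 1\<close> for all integers \<open>i\<close>.

  If no \<open>H\<^sub>n\<close> were \<open>G\<close>, there would be \<open>g\<^sub>n \<ge> id\<close> outside \<open>H\<^sub>2\<^sub>n\<close>.  One automorphism \<open>s\<close> can be chosen
  growing so fast that \<open>s\<^sup>-\<^sup>n\<^sup>-\<^sup>1 g\<^sub>n s\<^sup>n\<^sup>+\<^sup>1\<close> has displacement less than one at the integers for all \<open>n\<close>;
  as \<open>s\<^sup>n\<^sup>+\<^sup>1\<close> lies in \<open>H\<^sub>m\<^sub>+\<^sub>n\<close>, this puts \<open>g\<^sub>n\<close> into \<open>H\<^sub>m\<^sub>+\<^sub>n\<^sub>+\<^sub>2\<close>, a contradiction for large \<open>n\<close>.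
\<close>

unbundle no m_inv_syntax

subsection \<open>Order automorphisms and products with disjoint supports\<close>

definition autos :: "('a::linorder \<Rightarrow> 'a) set" where
  "autos = {f. bij f \<and> mono f}"

lemma carrier_Aut_Q: "carrier Aut_Q = autos"
  by (simp add: Aut_Q_def autos_def)

lemma autosI: "surj f \<Longrightarrow> strict_mono f \<Longrightarrow> f \<in> autos"
  for f :: "'a::linorder \<Rightarrow> 'a"
  by (auto simp: autos_def bij_def strict_mono_mono dest: strict_mono_imp_inj_on)

lemma autos_bij: "f \<in> autos \<Longrightarrow> bij f"
  by (simp add: autos_def)

lemma autos_eq_iff: "f \<in> autos \<Longrightarrow> f x = f y \<longleftrightarrow> x = y"
  by (simp add: autos_def bij_def inj_eq)

lemma autos_strict_mono: "f \<in> autos \<Longrightarrow> strict_mono f"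
  by (simp add: autos_def bij_def strict_mono_iff_mono)

lemma autos_less_iff: "f \<in> autos \<Longrightarrow> f x < f y \<longleftrightarrow> x < y"
  by (simp add: autos_strict_mono strict_mono_less)

lemma autos_le_iff: "f \<in> autos \<Longrightarrow> f x \<le> f y \<longleftrightarrow> x \<le> y"
  by (simp add: autos_strict_mono strict_mono_less_eq)

lemma autos_f_inv: "f \<in> autos \<Longrightarrow> f (inv f x) = x"
  by (simp add: autos_def bij_is_surj surj_f_inv_f)

lemma autos_inv_f [simp]: "f \<in> autos \<Longrightarrow> inv f (f x) = x"
  by (simp add: autos_def bij_is_inj)

lemma autos_inv_inv [simp]: "f \<in> autos \<Longrightarrow> inv (inv f) = f"
  by (simp add: autos_def inv_inv_eq)

lemma autos_comp [simp]: "f \<in> autos \<Longrightarrow> g \<in> autos \<Longrightarrow> f \<circ> g \<in> autos"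
  by (auto simp: autos_def bij_comp mono_def)

lemma autos_id [simp]: "id \<in> autos"
  by (simp add: autos_def mono_def)

lemma autos_inv [simp]:
  assumes "f \<in> autos"
  shows "inv f \<in> autos"
proof -
  have "inv f x < inv f y" if "x < y" for x y
  proof -
    have "f (inv f x) < f (inv f y)" using that assms by (simp add: autos_f_inv[of f])
    then show ?thesis by (simp only: autos_less_iff[OF assms])
  qed
  then have "strict_mono (inv f)" by (rule strict_monoI)
  moreover have "surj (inv f)" using assms by (metis autos_inv_f surjI)
  ultimately show ?thesis by (metis autosI)
qed

lemma autos_funpow [simp]: "f \<in> autos \<Longrightarrow> f ^^ n \<in> autos"
  by (induction n) auto

definition conj_by :: "('a \<Rightarrow> 'a) \<Rightarrow> ('a \<Rightarrow> 'a) \<Rightarrow> 'a \<Rightarrow> 'a" where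
  "conj_by t g = t \<circ> g \<circ> inv t"

lemma conj_by_apply: "conj_by t g x = t (g (inv t x))"
  by (simp add: conj_by_def)

lemma autos_conj_by [simp]: "t \<in> autos \<Longrightarrow> g \<in> autos \<Longrightarrow> conj_by t g \<in> autos"
  by (simp add: conj_by_def)

lemma conj_by_moves_iff: "t \<in> autos \<Longrightarrow> conj_by t g x \<noteq> x \<longleftrightarrow> g (inv t x) \<noteq> inv t x"
  unfolding conj_by_apply by (metis autos_f_inv autos_inv_f)

text \<open>The possibly infinite product of a family whose supports are pairwise disjoint. At most
  one factor moves a given point, so under the assumptions of the locale below the choice is
  unique.\<close>

definition glue :: "('i \<Rightarrow> 'a \<Rightarrow> 'a) \<Rightarrow> 'a \<Rightarrow> 'a" where
  "glue g x = (if \<exists>i. g i x \<noteq> x then g (SOME i. g i x \<noteq> x) x else x)"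

locale disjoint_supports =
  fixes g :: "'i \<Rightarrow> 'a::linorder \<Rightarrow> 'a"
  assumes aut: "g i \<in> autos"
    and disj: "i \<noteq> j \<Longrightarrow> g i x = x \<or> g j x = x"
begin

lemma glue_moved:
  assumes "g i x \<noteq> x"
  shows "glue g x = g i x"
proof -
  have "g (SOME i. g i x \<noteq> x) x \<noteq> x" using assms by (rule someI)
  then have "(SOME i. g i x \<noteq> x) = i" using disj assms by blast
  then show ?thesis using assms by (auto simp: glue_def)
qed

lemma glue_fixed: "(\<And>i. g i x = x) \<Longrightarrow> glue g x = x"
  by (simp add: glue_def)

text \<open>By injectivity \<open>g i\<close> maps its support to itself, so \<open>g i x\<close> is
  again moved by \<open>g i\<close> and hence fixed by every other factor.\<close>

lemma moved_image: "g i x \<noteq> x \<Longrightarrow> j \<noteq> i \<Longrightarrow> g j (g i x) = g i x"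
  using disj[of i j "g i x"] autos_eq_iff[OF aut[of i]] by auto

lemma glue_autos: "glue g \<in> autos"
proof (rule autosI)
  have "\<exists>x. glue g x = y" for y
  proof (cases "\<exists>i. g i y \<noteq> y")
    case True
    then obtain i where i: "g i y \<noteq> y" by blast
    define x where "x = inv (g i) y"
    have x: "g i x = y" by (simp add: x_def aut autos_f_inv)
    with i have "g i x \<noteq> x" by auto
    then have "glue g x = y" using x glue_moved[of i x] by metis
    then show ?thesis by blast
  next
    case False
    then have "glue g y = y" by (intro glue_fixed) blast
    then show ?thesis by blast
  qed
  then show "surj (glue g)" unfolding surj_def by metis
  show "strict_mono (glue g)"
  proof (rule strict_monoI)
    fix x y :: 'a assume "x < y"
    have same: "g i x < g i y" for i using \<open>x < y\<close> by (simp add: autos_less_iff[OF aut])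
    consider (both) i j where "g i x \<noteq> x" "g j y \<noteq> y"
      | (left) i where "g i x \<noteq> x" "\<And>j. g j y = y"
      | (right) j where "\<And>i. g i x = x" "g j y \<noteq> y"
      | (neither) "\<And>i. g i x = x" "\<And>j. g j y = y"
      by blast
    then show "glue g x < glue g y"
    proof cases
      case both
      show ?thesis
      proof (cases "i = j")
        case True
        then show ?thesis using same[of i] glue_moved[OF both(1)] glue_moved[OF both(2)] by simp
      next
        case False
        \<comment> \<open>As \<open>g j\<close> fixes \<open>x\<close>, applying it to
          \<open>x < y\<close> gives \<open>x < g j y\<close>. Applying \<open>g i\<close>, which
          fixes \<open>g j y\<close>, then gives \<open>g i x < g j y\<close>.\<close>
        have "g j x = x" using disj[OF False, of x] both by simp
        then have "x < g j y" using same[of j] by simp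
        then have "g i x < g i (g j y)" by (simp add: autos_less_iff[OF aut])
        then show ?thesis using moved_image[OF both(2) False]
          by (simp add: glue_moved[OF both(1)] glue_moved[OF both(2)])
      qed
    next
      case left
      then show ?thesis using same[of i] glue_moved[OF left(1)] glue_fixed[OF left(2)] by simp
    next
      case right
      then show ?thesis using same[of j] glue_moved[OF right(2)] glue_fixed[OF right(1)] by simp
    next
      case neither
      then show ?thesis using \<open>x < y\<close> glue_fixed[OF neither(1)] glue_fixed[OF neither(2)] by simp
    qed
  qed
qed

end

section \<open>Automorphisms supported on a set\<close>

definition supported_on :: "'a set \<Rightarrow> ('a::linorder \<Rightarrow> 'a) set" where
  "supported_on S = {g \<in> autos. \<forall>x. x \<notin> S \<longrightarrow> g x = x}"

lemma supported_on_autos: "g \<in> supported_on S \<Longrightarrow> g \<in> autos"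
  by (simp add: supported_on_def)

lemma supported_on_fixes: "g \<in> supported_on S \<Longrightarrow> x \<notin> S \<Longrightarrow> g x = x"
  by (simp add: supported_on_def)

text \<open>If \<open>g x\<close> lies outside \<open>S\<close>, then \<open>g\<close> fixes
  \<open>g x\<close>, and injectivity gives \<open>g x = x\<close>.\<close>

lemma supported_on_mem_iff: "g \<in> supported_on S \<Longrightarrow> g x \<in> S \<longleftrightarrow> x \<in> S"
  using autos_eq_iff[of g "g x" x] by (auto simp: supported_on_def)

lemma conj_by_supported_on:
  assumes t: "t \<in> autos" and g: "g \<in> supported_on S"
  shows "conj_by t g \<in> supported_on (t ` S)"
proof -
  have "conj_by t g x = x" if "x \<notin> t ` S" for x
  proof -
    have "inv t x \<notin> S" using that imageI[of "inv t x" S t] by (auto simp: autos_f_inv[OF t])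
    then show ?thesis using t g by (simp add: conj_by_apply supported_on_def autos_f_inv[OF t])
  qed
  then show ?thesis using t g by (simp add: supported_on_def)
qed

subsection \<open>Countable chains exhausting the automorphisms\<close>

text \<open>The chain is normalized so that products land in the very next member; passing to a
  subsequence achieves this. The goal is that some member is all of \<open>autos\<close>.\<close>

locale autos_chain =
  fixes H :: "nat \<Rightarrow> ('a::linorder \<Rightarrow> 'a) set"
  assumes mono_H: "mono H"
    and Un_H: "(\<Union>n. H n) = autos"
    and inv_H: "f \<in> H n \<Longrightarrow> inv f \<in> H n"
    and comp_H: "f \<in> H n \<Longrightarrow> g \<in> H n \<Longrightarrow> f \<circ> g \<in> H (Suc n)"
begin

lemma H_le: "f \<in> H m \<Longrightarrow> m \<le> n \<Longrightarrow> f \<in> H n"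
  using mono_H by (meson monoD subsetD)

lemma H_autos: "f \<in> H n \<Longrightarrow> f \<in> autos"
  using Un_H by blast

lemma autos_H: "f \<in> autos \<Longrightarrow> \<exists>n. f \<in> H n"
  using Un_H by blast

lemma conj_by_H: "t \<in> H n \<Longrightarrow> g \<in> H n \<Longrightarrow> conj_by t g \<in> H (Suc (Suc n))"
  unfolding conj_by_def by (meson H_le comp_H inv_H le_SucI order_refl)

text \<open>Each further factor \<open>f\<close> costs one step in the chain. This linear growth in
  the exponent is what is later beaten by the index \<open>2 * n\<close>.\<close>

lemma funpow_H: "f \<in> H m \<Longrightarrow> f ^^ Suc n \<in> H (m + n)"
proof (induction n)
  case (Suc n)
  then have "f \<circ> f ^^ Suc n \<in> H (Suc (m + n))"
    by (intro comp_H) (auto simp del: funpow.simps intro: H_le)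
  then show ?case by (metis add_Suc_right funpow.simps(2))
qed simp

text \<open>Conjugating back by \<open>inv t\<close> costs a bounded number of steps, because the
  fixed \<open>t\<close> lies in one member; so \<open>l\<close> does not depend on
  \<open>g\<close>.\<close>

lemma conj_subset_H:
  assumes "t \<in> autos" "A \<subseteq> H k"
  shows "\<exists>l. \<forall>g. conj_by t g \<in> A \<longrightarrow> g \<in> autos \<longrightarrow> g \<in> H l"
proof -
  obtain m where m: "t \<in> H m" using assms autos_H by blast
  have "g \<in> H (Suc (Suc (max m k)))" if "conj_by t g \<in> A" "g \<in> autos" for g
  proof -
    have "conj_by (inv t) (conj_by t g) \<in> H (Suc (Suc (max m k)))"
      using that assms m by (intro conj_by_H) (auto intro: H_le inv_H)
    moreover have "conj_by (inv t) (conj_by t g) = g"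
      using assms by (auto simp: conj_by_apply fun_eq_iff)
    ultimately show ?thesis by simp
  qed
  then show ?thesis by blast
qed

text \<open>Otherwise every \<open>n\<close> has a \<open>g n\<close> supported on
  \<open>S n\<close> that no element of \<open>H n\<close> matches there. The product of all
  \<open>g n\<close> lies in some \<open>H m\<close> and matches \<open>g m\<close> on
  \<open>S m\<close>, a contradiction.\<close>

lemma diagonal:
  fixes S :: "nat \<Rightarrow> 'a set"
  assumes S: "\<And>i j. i \<noteq> j \<Longrightarrow> S i \<inter> S j = {}"
  shows "\<exists>n. \<forall>g\<in>supported_on (S n). \<exists>h\<in>H n. \<forall>x\<in>S n. h x = g x"
proof (rule ccontr)
  assume "\<not> ?thesis"
  then obtain g where g: "\<And>n. g n \<in> supported_on (S n)"
    and no: "\<And>n. \<forall>h\<in>H n. \<exists>x\<in>S n. h x \<noteq> g n x" by metis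
  interpret disjoint_supports g
    using g S by unfold_locales (auto simp: supported_on_def disjoint_iff, metis)
  obtain m where "glue g \<in> H m" using glue_autos autos_H by blast
  then obtain x where x: "x \<in> S m" "glue g x \<noteq> g m x" using no by blast
  then have "g m x = x" using glue_moved by metis
  moreover have "g i x = x" if "i \<noteq> m" for i
    using S[OF that] x g[of i] by (auto simp: supported_on_def)
  ultimately show False using x glue_fixed by metis
qed

text \<open>
  With the infinite product \<open>f = \<Prod>\<^sub>i b\<^sup>i g b\<^sup>-\<^sup>i\<close> one has \<open>g = f b f\<^sup>-\<^sup>1 b\<^sup>-\<^sup>1\<close>, and the commutator does
  not change when \<open>f\<close> is replaced by any \<open>h\<close> that agrees with \<open>f\<close> on the support of \<open>b\<close>.
\<close>

lemma commutator:
  assumes b: "b \<in> supported_on S" and TS: "T \<subseteq> S"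
    and T: "\<And>i x. x \<in> T \<Longrightarrow> (b ^^ Suc i) x \<notin> T"
    and approx: "\<And>g. g \<in> supported_on S \<Longrightarrow> \<exists>h\<in>H n. \<forall>x\<in>S. h x = g x"
  shows "\<exists>k. supported_on T \<subseteq> H k"
proof -
  have ba [simp]: "b \<in> autos" using b supported_on_autos by blast
  obtain m where m: "b \<in> H m" using autos_H by fastforce
  have "g \<in> H (Suc (Suc (max m n)))" if gT: "g \<in> supported_on T" for g
  proof -
    have ga [simp]: "g \<in> autos" using gT supported_on_autos by blast
    \<comment> \<open>\<open>c i\<close> moves only points in the image of \<open>T\<close> under
      \<open>b ^^ i\<close>. These images are pairwise disjoint, since no positive power of
      \<open>b\<close> brings a point of \<open>T\<close> back to \<open>T\<close>.\<close>
    define c where "c i = conj_by (b ^^ i) g" for i :: nat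
    have c_mem: "inv (b ^^ i) x \<in> T" if "c i x \<noteq> x" for i x
      using that conj_by_moves_iff[of "b ^^ i" g x] gT unfolding c_def supported_on_def by auto
    have c0: "c 0 = g" by (simp add: c_def conj_by_def)
    have cb: "c (Suc i) (b y) = b (c i y)" for i y
    proof -
      have "(b ^^ Suc i) (inv (b ^^ i) y) = b y" by (simp add: autos_f_inv[of "b ^^ i"])
      then have "inv (b ^^ Suc i) (b y) = inv (b ^^ i) y"
        by (metis autos_funpow autos_inv_f ba)
      then show ?thesis by (simp add: c_def conj_by_apply)
    qed
    have c_disj: "c i x = x \<or> c j x = x" if "i < j" for i j x
    proof (rule ccontr)
      assume "\<not> ?thesis"
      then have x: "inv (b ^^ i) x \<in> T" "inv (b ^^ j) x \<in> T" using c_mem by auto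
      obtain d where j: "j = i + Suc d" using \<open>i < j\<close> less_iff_Suc_add by auto
      define y where "y = inv (b ^^ j) x"
      have "x = (b ^^ i) ((b ^^ Suc d) y)"
        using autos_f_inv[of "b ^^ j" x] unfolding y_def j
        by (metis autos_funpow ba comp_apply funpow_add)
      then have "inv (b ^^ i) x = (b ^^ Suc d) y"
        by (metis autos_funpow autos_inv_f ba)
      then show False using T[of y d] x unfolding y_def by simp
    qed
    interpret disjoint_supports c
      using c_disj by unfold_locales (simp add: c_def, metis nat_neq_iff)
    define f where "f = glue c"
    \<comment> \<open>The identity \<open>g = f b f\<^sup>-\<^sup>1 b\<^sup>-\<^sup>1\<close>
      without inverses: conjugating \<open>f\<close> by \<open>b\<close> shifts all factors by one
      index and loses only \<open>c 0 = g\<close>.\<close>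
    have fb: "f (b y) = g (b (f y))" for y
    proof (cases "\<exists>i. c i y \<noteq> y")
      case True
      then obtain i where i: "c i y \<noteq> y" by blast
      then have i': "c (Suc i) (b y) \<noteq> b y" by (simp add: cb autos_eq_iff[OF ba])
      have "f (b y) = b (f y)" using glue_moved[OF i] glue_moved[OF i'] by (simp add: f_def cb)
      moreover have "g (f (b y)) = f (b y)"
        using moved_image[OF i', of 0] glue_moved[OF i'] by (simp add: f_def c0)
      ultimately show ?thesis by simp
    next
      case False
      then have y: "f y = y" by (simp add: f_def glue_fixed)
      show ?thesis
      proof (cases "g (b y) = b y")
        case True
        have "c i (b y) = b y" for i
          by (cases i) (use True False in \<open>auto simp: c0 cb\<close>)
        then show ?thesis by (simp add: f_def glue_fixed True y[unfolded f_def])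
      next
        case g: False
        then show ?thesis using glue_moved[of 0 "b y"] by (simp add: f_def y[unfolded f_def] c0)
      qed
    qed
    have bS: "b x \<in> S \<longleftrightarrow> x \<in> S" for x using b by (rule supported_on_mem_iff)
    have bpow: "(b ^^ i) x \<in> S \<longleftrightarrow> x \<in> S" for i x
      by (induction i) (auto simp: bS)
    have "f x = x" if "x \<notin> S" for x
      unfolding f_def
    proof (rule glue_fixed, rule ccontr)
      fix i assume "c i x \<noteq> x"
      then have "inv (b ^^ i) x \<in> S" using c_mem TS by blast
      then show False using bpow[of i "inv (b ^^ i) x"] that by (simp add: autos_f_inv[of "b ^^ i"])
    qed
    then have fS: "f \<in> supported_on S"
      using glue_autos by (auto simp: supported_on_def f_def)
    obtain h where h: "h \<in> H n" "\<And>x. x \<in> S \<Longrightarrow> h x = f x" using approx[OF fS] by blast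
    have ha [simp]: "h \<in> autos" using h H_autos by blast
    \<comment> \<open>\<open>h\<close> agrees on \<open>S\<close> with \<open>f\<close>, which
      permutes \<open>S\<close>. So \<open>h\<close> already takes every value in \<open>S\<close>
      on \<open>S\<close>, and injectivity keeps the complement of \<open>S\<close> outside
      \<open>S\<close>.\<close>
    have hS: "h x \<notin> S" if "x \<notin> S" for x
    proof
      assume "h x \<in> S"
      have fa: "f \<in> autos" using fS supported_on_autos by blast
      define y where "y = inv f (h x)"
      have "f y = h x" by (simp add: y_def autos_f_inv[OF fa])
      then have "y \<in> S" using supported_on_mem_iff[OF fS, of y] \<open>h x \<in> S\<close> by simp
      then have "h y = h x" using h \<open>f y = h x\<close> by simp
      then show False using \<open>y \<in> S\<close> that by (auto simp: autos_eq_iff[OF ha])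
    qed
    have "g (b (h y)) = h (b y)" for y
    proof (cases "y \<in> S")
      case True
      then show ?thesis using h fb bS by simp
    next
      case False
      then show ?thesis using hS[OF False] b gT TS by (auto simp: supported_on_def)
    qed
    then have "g x = h (b (inv h (inv b x)))" for x
      by (metis autos_f_inv ba ha)
    then have "g = (h \<circ> b) \<circ> (inv h \<circ> inv b)" by auto
    moreover have "(h \<circ> b) \<circ> (inv h \<circ> inv b) \<in> H (Suc (Suc (max m n)))"
      using h m by (intro comp_H) (auto intro: H_le inv_H)
    ultimately show ?thesis by simp
  qed
  then show ?thesis by blast
qed

end

subsection \<open>Piecewise linear automorphisms of the rationals\<close>

lemma strict_mono_int_stepI:
  fixes v :: "int \<Rightarrow> 'a::order"
  assumes "\<And>k. v k < v (k + 1)"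
  shows "strict_mono v"
proof (rule strict_monoI)
  fix i j :: int assume "i < j"
  then show "v i < v j"
  proof (induction j rule: int_gr_induct)
    case base
    show ?case by (rule assms)
  next
    case (step j)
    then show ?case using assms[of j] by (metis less_trans)
  qed
qed

text \<open>The piecewise linear map through the points \<open>(k, v k)\<close>. The shifts and the
  fast growing automorphism below are built by prescribing their values at the integers.\<close>

definition interpolate :: "(int \<Rightarrow> rat) \<Rightarrow> rat \<Rightarrow> rat" where
  "interpolate v x = v \<lfloor>x\<rfloor> + frac x * (v (\<lfloor>x\<rfloor> + 1) - v \<lfloor>x\<rfloor>)"

lemma interpolate_of_int [simp]: "interpolate v (of_int k) = v k"
  by (simp add: interpolate_def)

lemma interpolate_ident:
  "v \<lfloor>x\<rfloor> = of_int \<lfloor>x\<rfloor> \<Longrightarrow> v (\<lfloor>x\<rfloor> + 1) = of_int (\<lfloor>x\<rfloor> + 1) \<Longrightarrow> interpolate v x = x"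
  by (simp add: interpolate_def frac_def)

text \<open>The map is increasing on each unit interval and sends it into
  \<open>[v k, v (k + 1))\<close>. These intervals cover the line because \<open>v\<close> is
  unbounded in both directions.\<close>

lemma interpolate_autos:
  assumes step: "\<And>k. v k < v (k + 1)"
    and below: "\<And>y. \<exists>k. v k \<le> y" and above: "\<And>y. \<exists>k. y < v k"
  shows "interpolate v \<in> autos"
proof (rule autosI)
  have mono: "v i < v j" if "i < j" for i j
    using strict_mono_int_stepI[of v, OF step] that by (rule strict_monoD)
  have low: "v \<lfloor>x\<rfloor> \<le> interpolate v x" for x
    using step[of "\<lfloor>x\<rfloor>"] by (simp add: interpolate_def frac_ge_0)
  have high: "interpolate v x < v (\<lfloor>x\<rfloor> + 1)" for x
  proof -
    have "frac x * (v (\<lfloor>x\<rfloor> + 1) - v \<lfloor>x\<rfloor>) < 1 * (v (\<lfloor>x\<rfloor> + 1) - v \<lfloor>x\<rfloor>)"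
      using step[of "\<lfloor>x\<rfloor>"] by (intro mult_strict_right_mono) (auto simp: frac_lt_1)
    then show ?thesis by (simp add: interpolate_def)
  qed
  show "strict_mono (interpolate v)"
  proof (rule strict_monoI)
    fix x y :: rat assume "x < y"
    then consider "\<lfloor>x\<rfloor> = \<lfloor>y\<rfloor>" | "\<lfloor>x\<rfloor> + 1 = \<lfloor>y\<rfloor>" | "\<lfloor>x\<rfloor> + 1 < \<lfloor>y\<rfloor>"
      using floor_mono[of x y] by linarith
    then show "interpolate v x < interpolate v y"
    proof cases
      case 1
      then have "frac x < frac y" using \<open>x < y\<close> by (simp add: frac_def)
      then show ?thesis using step[of "\<lfloor>y\<rfloor>"] 1 by (simp add: interpolate_def)
    next
      case 2
      then show ?thesis using high[of x] low[of y] by simp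
    next
      case 3
      then show ?thesis using high[of x] low[of y] mono[OF 3] by simp
    qed
  qed
  have "\<exists>x. interpolate v x = y" for y
  proof -
    obtain k0 where k0: "v k0 \<le> y" using below by blast
    obtain k1 where k1: "y < v k1" using above by blast
    have "\<exists>k. v k \<le> y \<and> y < v (k + 1)"
    proof (rule ccontr)
      assume no: "\<nexists>k. v k \<le> y \<and> y < v (k + 1)"
      have "v k \<le> y" if "k0 \<le> k" for k
        using that
      proof (induction k rule: int_ge_induct)
        case base
        show ?case by (rule k0)
      next
        case (step k)
        then show ?case using no by (metis not_le)
      qed
      then have "k1 < k0" using k1 by (metis not_le)
      then have "v k1 < v k0" by (rule mono)
      then show False using k0 k1 by simp
    qed
    then obtain k where k: "v k \<le> y" "y < v (k + 1)" by blast
    \<comment> \<open>The proportion of the interval from \<open>v k\<close> to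
      \<open>v (k + 1)\<close> that lies below \<open>y\<close>; by linearity \<open>y\<close> is
      attained at \<open>k + d\<close>.\<close>
    define d where "d = (y - v k) / (v (k + 1) - v k)"
    have d: "0 \<le> d" "d < 1" "d * (v (k + 1) - v k) = y - v k"
      using k step[of k] by (auto simp: d_def)
    have "\<lfloor>of_int k + d\<rfloor> = k" using d by (simp add: floor_unique)
    then have "interpolate v (of_int k + d) = y"
      using d by (simp add: interpolate_def frac_def)
    then show ?thesis by blast
  qed
  then show "surj (interpolate v)" by (metis surjI)
qed

lemma interpolate_autos_bounded:
  assumes step: "\<And>k. v k < v (k + 1)" and bound: "\<And>k. \<bar>v k - of_int k\<bar> \<le> C"
  shows "interpolate v \<in> autos"
proof (rule interpolate_autos[of v, OF step])
  fix y
  have "v \<lfloor>y - C\<rfloor> \<le> y"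
    using bound[of "\<lfloor>y - C\<rfloor>"] by linarith
  then show "\<exists>k. v k \<le> y" ..
  have "y < v (\<lfloor>y + C\<rfloor> + 1)"
    using bound[of "\<lfloor>y + C\<rfloor> + 1"] by linarith
  then show "\<exists>k. y < v k" ..
qed

section \<open>Translations, and shifts moving unions of intervals off themselves\<close>

lemma translation_autos: "(\<lambda>x. x + a) \<in> autos" for a :: rat
proof (rule autosI)
  show "surj (\<lambda>x. x + a)" by (rule surjI[of _ "\<lambda>x. x - a"]) simp
  show "strict_mono (\<lambda>x. x + a)" by (rule strict_monoI) simp
qed

lemma conj_by_translation: "conj_by (\<lambda>x. x + a) g x = g (x - a) + a" for a :: rat
proof -
  have "inv (\<lambda>x. x + a) x = x - a"
    using autos_inv_f[OF translation_autos, of a "x - a"] by simp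
  then show ?thesis by (simp add: conj_by_apply)
qed

text \<open>Half of the intervals \<open>[4j, 4j + 4)\<close>; translation by 4 exchanges this set
  with its complement.\<close>

definition even_blocks :: "rat set" where
  "even_blocks = {x. even \<lfloor>x / 4\<rfloor>}"

lemma even_blocks_iff: "x \<in> even_blocks \<longleftrightarrow> (\<exists>q. 8 * of_int q \<le> x \<and> x < 8 * of_int q + 4)"
proof
  assume "x \<in> even_blocks"
  then obtain q where "\<lfloor>x / 4\<rfloor> = 2 * q" by (auto simp: even_blocks_def elim: evenE)
  then have "of_int (2 * q) \<le> x / 4" "x / 4 < of_int (2 * q) + 1" by (simp_all add: floor_eq_iff)
  then show "\<exists>q. 8 * of_int q \<le> x \<and> x < 8 * of_int q + 4"
    by (intro exI[of _ q]) (simp add: field_simps)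
next
  assume "\<exists>q. 8 * of_int q \<le> x \<and> x < 8 * of_int q + 4"
  then obtain q where "8 * of_int q \<le> x" "x < 8 * of_int q + 4" by blast
  then have "\<lfloor>x / 4\<rfloor> = 2 * q" by (simp add: floor_eq_iff field_simps)
  then show "x \<in> even_blocks" by (simp add: even_blocks_def)
qed

text \<open>Each even block enlarged by one on both sides. This leaves room to push the even block
  aside within the wide one, and gaps of length two between wide blocks.\<close>

definition wide_blocks :: "rat set" where
  "wide_blocks = {x. \<exists>q. 8 * of_int q - 1 \<le> x \<and> x < 8 * of_int q + 5}"

text \<open>\<open>b\<close> maps \<open>[l, r)\<close> into \<open>[m, r)\<close>, which is
  contained in \<open>[l, r)\<close>; hence all further iterates stay in
  \<open>[m, r)\<close>.\<close>

lemma blocks_mapped_off: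
  fixes b :: "rat \<Rightarrow> rat"
  assumes b: "b \<in> autos" and x: "l \<le> x" "x < r" and lm: "b l = m" "l \<le> m" and r: "b r = r"
  shows "m \<le> (b ^^ Suc i) x \<and> (b ^^ Suc i) x < r"
proof (induction i)
  case 0
  have "b l \<le> b x" "b x < b r" using x by (simp_all only: autos_le_iff[OF b] autos_less_iff[OF b])
  then show ?case using lm r by simp
next
  case (Suc i)
  define y where "y = (b ^^ Suc i) x"
  have "l \<le> y" "y < r" using Suc lm by (auto simp: y_def)
  then have "b l \<le> b y" "b y < b r" by (simp_all only: autos_le_iff[OF b] autos_less_iff[OF b])
  then show ?case using lm r by (simp add: y_def)
qed

lemma inner_shift:
  "\<exists>b \<in> supported_on wide_blocks. \<forall>i. \<forall>x\<in>even_blocks. (b ^^ Suc i) x \<notin> even_blocks"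
proof -
  \<comment> \<open>Residues 0 to 5 compress \<open>[8q, 8q + 5]\<close> onto
    \<open>[8q + 4, 8q + 5]\<close>, beside the even block but inside the wide one. Residues 6 and 7
    stay fixed, and \<open>[8q - 1, 8q]\<close> is stretched to fill the space left.\<close>
  define v :: "int \<Rightarrow> rat" where
    "v k = (if k mod 8 \<le> 5 then of_int (8 * (k div 8) + 4) + of_int (k mod 8) / 5 else of_int k)" for k
  have v: "v (8 * q + r) = (if r \<le> 5 then 8 * of_int q + 4 + of_int r / 5 else 8 * of_int q + of_int r)"
    if "0 \<le> r" "r \<le> 7" for q r
  proof -
    have "(8 * q + r) mod 8 = r" "(8 * q + r) div 8 = q" using that by presburger+
    then show ?thesis by (simp add: v_def)
  qed
  have v0: "v (8 * q) = 8 * of_int q + 4" for q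
    using v[of 0 q] by simp
  have v8: "v (8 * q + 8) = 8 * of_int q + 12" for q
    using v[of 0 "q + 1"] by (simp add: algebra_simps)
  have split: "\<exists>q r. k = 8 * q + r \<and> r \<in> {0, 1, 2, 3, 4, 5, 6, 7}" for k :: int
    by (rule exI[of _ "k div 8"], rule exI[of _ "k mod 8"]) (simp, presburger)
  have auto: "interpolate v \<in> autos"
  proof (rule interpolate_autos_bounded[of _ 8])
    fix k :: int
    obtain q r where k: "k = 8 * q + r" "r \<in> {0, 1, 2, 3, 4, 5, 6, 7}" using split by blast
    then show "v k < v (k + 1)"
      by (auto simp: v v0 v8 add.assoc)
    show "\<bar>v k - of_int k\<bar> \<le> 8"
      using k by (auto simp: v v0)
  qed
  have "interpolate v x = x" if "x \<notin> wide_blocks" for x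
  proof -
    obtain q r where qr: "\<lfloor>x\<rfloor> = 8 * q + r" "r \<in> {0, 1, 2, 3, 4, 5, 6, 7}" using split by blast
    have *: "of_int (8 * q + r) \<le> x" "x < of_int (8 * q + r) + 1"
      using qr(1) by (simp_all add: floor_eq_iff)
    have "\<not> (8 * of_int q - 1 \<le> x \<and> x < 8 * of_int q + 5)"
      "\<not> (8 * of_int (q + 1) - 1 \<le> x \<and> x < 8 * of_int (q + 1) + 5)"
      using that unfolding wide_blocks_def by blast+
    \<comment> \<open>Off the wide blocks only these two residues occur, and \<open>v\<close> fixes
      both ends of the corresponding unit intervals.\<close>
    then have "r = 5 \<or> r = 6" using * qr(2) by auto
    then show ?thesis by (intro interpolate_ident) (auto simp: qr(1) v add.assoc)
  qed
  then have "interpolate v \<in> supported_on wide_blocks"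
    using auto by (simp add: supported_on_def)
  moreover have "(interpolate v ^^ Suc i) x \<notin> even_blocks" if x: "x \<in> even_blocks" for i x
  proof -
    obtain q where q: "8 * of_int q \<le> x" "x < 8 * of_int q + 4"
      using x unfolding even_blocks_iff by blast
    have *: "8 * of_int q + 4 \<le> (interpolate v ^^ Suc i) x \<and> (interpolate v ^^ Suc i) x < 8 * of_int q + 5"
    proof (rule blocks_mapped_off[OF auto, of "8 * of_int q"])
      show "interpolate v (8 * of_int q) = 8 * of_int q + 4"
        using interpolate_of_int[of v "8 * q"] v[of 0 q] by simp
      show "interpolate v (8 * of_int q + 5) = 8 * of_int q + 5"
        using interpolate_of_int[of v "8 * q + 5"] v[of 5 q] by simp
    qed (use q in auto)
    define y where "y = (interpolate v ^^ Suc i) x"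
    have "\<lfloor>y / 4\<rfloor> = 2 * q + 1" using * unfolding y_def[symmetric]
      by (simp add: floor_eq_iff field_simps)
    then show ?thesis unfolding y_def[symmetric] by (simp add: even_blocks_def)
  qed
  ultimately show ?thesis by blast
qed

text \<open>Pushes every wide block into the gap to its right. The images of
  \<open>wide_blocks\<close> under the powers of \<open>u\<close> are then pairwise disjoint, as the
  diagonal argument requires.\<close>

lemma outer_shift:
  "\<exists>u \<in> autos. \<forall>i. \<forall>x\<in>wide_blocks. (u ^^ Suc i) x \<notin> wide_blocks"
proof -
  \<comment> \<open>The fixed points are the \<open>8q - 2\<close>, so residues are counted from
    there. The interval \<open>[8q - 1, 8q + 6]\<close> is compressed onto
    \<open>[8q + 5, 8q + 6]\<close>.\<close>
  define v :: "int \<Rightarrow> rat" where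
    "v k = of_int (8 * ((k + 2) div 8) - 2) +
      (if (k + 2) mod 8 = 0 then 0 else 7 + of_int ((k + 2) mod 8 - 1) / 7)" for k
  have v: "v (8 * q + r) = 8 * of_int q - 2 + (if r = -2 then 0 else 7 + (of_int r + 1) / 7)"
    if "-2 \<le> r" "r \<le> 5" for q r
  proof -
    have "(8 * q + r + 2) mod 8 = r + 2" "(8 * q + r + 2) div 8 = q" using that by presburger+
    then show ?thesis by (simp add: v_def)
  qed
  have v0: "v (8 * q) = 8 * of_int q - 2 + (7 + 1 / 7)" for q
    using v[of 0 q] by simp
  have v6: "v (8 * q + 6) = 8 * of_int q + 6" for q
    using v[of "-2" "q + 1"] by (simp add: algebra_simps)
  have split: "\<exists>q r. k = 8 * q + r \<and> r \<in> {-2, -1, 0, 1, 2, 3, 4, 5}" for k :: int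
    by (rule exI[of _ "(k + 2) div 8"], rule exI[of _ "(k + 2) mod 8 - 2"]) (simp, presburger)
  have auto: "interpolate v \<in> autos"
  proof (rule interpolate_autos_bounded[of _ 8])
    fix k :: int
    obtain q r where k: "k = 8 * q + r" "r \<in> {-2, -1, 0, 1, 2, 3, 4, 5}" using split by blast
    have plus: "8 * q + r + 1 = 8 * q + (r + 1)" by simp
    show "v k < v (k + 1)"
      unfolding k(1) plus using k(2) by (elim insertE) (auto simp: v v0 v6 simp del: add_uminus_conv_diff)
    show "\<bar>v k - of_int k\<bar> \<le> 8"
      unfolding k(1) using k(2) by (elim insertE) (auto simp: v v0 simp del: add_uminus_conv_diff)
  qed
  moreover have "(interpolate v ^^ Suc i) x \<notin> wide_blocks" if x: "x \<in> wide_blocks" for i x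
  proof -
    obtain q where q: "8 * of_int q - 1 \<le> x" "x < 8 * of_int q + 5"
      using x unfolding wide_blocks_def by blast
    have *: "8 * of_int q + 5 \<le> (interpolate v ^^ Suc i) x \<and> (interpolate v ^^ Suc i) x < 8 * of_int q + 6"
    proof (rule blocks_mapped_off[OF auto, of "8 * of_int q - 1"])
      show "interpolate v (8 * of_int q - 1) = 8 * of_int q + 5"
        using interpolate_of_int[of v "8 * q - 1"] v[of "-1" q] by simp
      show "interpolate v (8 * of_int q + 6) = 8 * of_int q + 6"
        using interpolate_of_int[of v "8 * q + 6"] v6[of q] by simp
    qed (use q in auto)
    show ?thesis
    proof
      assume "(interpolate v ^^ Suc i) x \<in> wide_blocks"
      then obtain p where p: "8 * of_int p - 1 \<le> (interpolate v ^^ Suc i) x"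
          "(interpolate v ^^ Suc i) x < 8 * of_int p + 5"
        unfolding wide_blocks_def by blast
      have "(of_int (8 * q + 5) :: rat) < of_int (8 * p + 5)"
        "(of_int (8 * p - 1) :: rat) < of_int (8 * q + 6)"
        using * p by simp_all
      then show False unfolding of_int_less_iff by presburger
    qed
  qed
  ultimately show ?thesis by blast
qed

section \<open>Factoring automorphisms through stabilizers of arithmetic progressions\<close>

lemma blockwise_autos:
  fixes g :: "'a::linorder \<Rightarrow> 'a" and c :: "'a \<Rightarrow> 'b::linorder"
  assumes g: "g \<in> autos" and c: "mono c" "\<And>x. c (g x) = c x"
  shows "(\<lambda>x. if P (c x) then g x else x) \<in> autos" (is "?f \<in> _")
proof (rule autosI)
  have cf: "c (?f x) = c x" for x using c by simp
  have "\<exists>x. ?f x = y" for y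
  proof (cases "P (c y)")
    case True
    have "g (inv g y) = y" using g by (rule autos_f_inv)
    moreover from this have "c (inv g y) = c y" using c(2)[of "inv g y"] by simp
    ultimately have "?f (inv g y) = y" using True by simp
    then show ?thesis by blast
  qed auto
  then show "surj ?f" unfolding surj_def by metis
  show "strict_mono ?f"
  proof (rule strict_monoI)
    fix x y :: 'a assume "x < y"
    then have "c x \<le> c y" using c(1) by (simp add: monoD)
    \<comment> \<open>Points with the same label are subject to the same map. Points with different
      labels keep their labels, and the monotone \<open>c\<close> then determines their
      order.\<close>
    show "?f x < ?f y"
    proof (cases "c x = c y")
      case True
      then show ?thesis using \<open>x < y\<close> autos_less_iff[OF g, of x y] by simp
    next
      case False
      with \<open>c x \<le> c y\<close> have "c (?f x) < c (?f y)" unfolding cf by simp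
      then show ?thesis using monoD[OF c(1)] by (metis not_le)
    qed
  qed
qed

text \<open>The pointwise stabilizer of the progression of all \<open>4k + a\<close>.\<close>

definition fixing :: "rat \<Rightarrow> (rat \<Rightarrow> rat) set" where
  "fixing a = {g \<in> autos. \<forall>k. g (4 * of_int k + a) = 4 * of_int k + a}"

text \<open>An automorphism fixing all multiples of 4 preserves every block
  \<open>[4j, 4j + 4)\<close>, so its actions on even and on odd blocks are automorphisms of their
  own.\<close>

lemma fixing_factor:
  assumes "g \<in> fixing 0"
  shows "\<exists>g1\<in>supported_on even_blocks. \<exists>g2\<in>supported_on (- even_blocks). g = g1 \<circ> g2"
proof -
  define c :: "rat \<Rightarrow> int" where "c x = \<lfloor>x / 4\<rfloor>" for x
  have g: "g \<in> autos" "\<And>k. g (4 * of_int k) = 4 * of_int k"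
    using assms by (auto simp: fixing_def)
  have mono: "mono c" by (rule monoI) (simp add: c_def floor_mono)
  have cg: "c (g x) = c x" for x
  proof -
    have "of_int (c x) \<le> x / 4" "x / 4 < of_int (c x) + 1"
      unfolding c_def by linarith+
    then have x: "4 * of_int (c x) \<le> x" "x < 4 * of_int (c x + 1)" by auto
    have "g (4 * of_int (c x)) \<le> g x" "g x < g (4 * of_int (c x + 1))"
      using x by (simp_all only: autos_le_iff[OF g(1)] autos_less_iff[OF g(1)])
    then have "4 * of_int (c x) \<le> g x" "g x < 4 * of_int (c x + 1)"
      by (simp_all only: g(2))
    then show ?thesis unfolding c_def[of "g x"] by (simp add: floor_eq_iff)
  qed
  define g1 where "g1 x = (if even (c x) then g x else x)" for x
  define g2 where "g2 x = (if odd (c x) then g x else x)" for x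
  have "g1 \<in> supported_on even_blocks"
    unfolding supported_on_def g1_def
    using blockwise_autos[OF g(1) mono cg, of even] by (simp add: even_blocks_def c_def)
  moreover have "g2 \<in> supported_on (- even_blocks)"
    unfolding supported_on_def g2_def
    using blockwise_autos[OF g(1) mono cg, of odd] by (simp add: even_blocks_def c_def)
  moreover have "g = g1 \<circ> g2"
    by (rule ext) (simp add: g1_def g2_def cg)
  ultimately show ?thesis by blast
qed

lemma unit_displacement_factor:
  assumes g: "g \<in> autos" and disp: "\<And>k. of_int k \<le> g (of_int k) \<and> g (of_int k) < of_int k + 1"
  shows "\<exists>p\<in>fixing 2. \<exists>q\<in>fixing 0. g = p \<circ> q"
proof -
  \<comment> \<open>\<open>p\<close> copies \<open>g\<close> at the multiples of 4 and fixes all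
    other integers; displacement less than one keeps \<open>v\<close> strictly increasing. So
    \<open>p\<close> fixes every \<open>4k + 2\<close>, and \<open>inv p \<circ> g\<close> fixes
    every \<open>4k\<close>.\<close>
  define v :: "int \<Rightarrow> rat" where "v k = (if 4 dvd k then g (of_int k) else of_int k)" for k
  define p where "p = interpolate v"
  have p: "p \<in> autos" unfolding p_def
  proof (rule interpolate_autos_bounded[of v 1])
    fix k :: int
    have "4 dvd k \<Longrightarrow> \<not> 4 dvd k + 1" by presburger
    then show "v k < v (k + 1)" using disp[of k] disp[of "k + 1"] by (auto simp: v_def)
    show "\<bar>v k - of_int k\<bar> \<le> 1" using disp[of k] by (auto simp: v_def)
  qed
  have "p (4 * of_int k + 2) = 4 * of_int k + 2" for k
  proof -
    have "p (of_int (4 * k + 2)) = v (4 * k + 2)" unfolding p_def by (rule interpolate_of_int)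
    moreover have "\<not> 4 dvd 4 * k + 2" by presburger
    ultimately show ?thesis by (simp add: v_def)
  qed
  then have "p \<in> fixing 2" using p by (simp add: fixing_def)
  moreover have "inv p \<circ> g \<in> fixing 0"
  proof -
    have "inv p (g (4 * of_int k)) = 4 * of_int k" for k
    proof -
      have "p (of_int (4 * k)) = v (4 * k)" unfolding p_def by (rule interpolate_of_int)
      then have "p (4 * of_int k) = g (4 * of_int k)" by (simp add: v_def)
      then show ?thesis using autos_inv_f[OF p] by metis
    qed
    then show ?thesis using p g by (simp add: fixing_def)
  qed
  moreover have "g = p \<circ> (inv p \<circ> g)"
    by (rule ext) (simp add: autos_f_inv[OF p])
  ultimately show ?thesis by blast
qed

text \<open>
  A single \<open>s\<close> works for all \<open>n\<close>: if \<open>s\<close> is sparse for \<open>g 0, \<dots>, g n\<close> at distance at least \<open>n\<close>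
  from zero, then so is its iterate for \<open>g n\<close>, because \<open>s\<^sup>n\<close> moves nonzero integers that far.
\<close>

lemma sparse_iterates:
  fixes g :: "nat \<Rightarrow> rat \<Rightarrow> rat"
  assumes g: "\<And>n. g n \<in> autos"
  shows "\<exists>s\<in>autos. \<forall>n k. g n ((s ^^ Suc n) (of_int k)) < (s ^^ Suc n) (of_int (k + 1))"
proof -
  \<comment> \<open>The two halves of an integer sequence running outwards from 0. Each new term of
    \<open>a\<close> exceeds the values of \<open>g i\<close> at the previous term, and each new
    term of \<open>c\<close> lies below the preimages under \<open>g i\<close>, for the finitely
    many \<open>i \<le> j + 1\<close>. The summand \<open>j + 2\<close> forces growth away from
    zero.\<close>
  define a :: "nat \<Rightarrow> int" where
    "a = rec_nat 0 (\<lambda>j x. x + int j + 2 + (\<Sum>i\<le>j+1. \<bar>\<lceil>g i (of_int x)\<rceil>\<bar>))"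
  define c :: "nat \<Rightarrow> int" where
    "c = rec_nat 0 (\<lambda>j x. x - int j - 2 - (\<Sum>i\<le>j+1. \<bar>\<lfloor>inv (g i) (of_int x)\<rfloor>\<bar>))"
  have a0: "a 0 = 0" and c0: "c 0 = 0" by (simp_all add: a_def c_def)
  have a_Suc: "a (Suc j) = a j + int j + 2 + (\<Sum>i\<le>j+1. \<bar>\<lceil>g i (of_int (a j))\<rceil>\<bar>)" for j
    by (simp add: a_def)
  have c_Suc: "c (Suc j) = c j - int j - 2 - (\<Sum>i\<le>j+1. \<bar>\<lfloor>inv (g i) (of_int (c j))\<rfloor>\<bar>)" for j
    by (simp add: c_def)
  have a_ge: "int j \<le> a j" and a_step: "a (Suc j) \<ge> a j + int j + 2" for j
  proof -
    have nn: "0 \<le> (\<Sum>i\<le>j+1. \<bar>\<lceil>g i (of_int (a j))\<rceil>\<bar>)" for j by (rule sum_nonneg) simp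
    show "a (Suc j) \<ge> a j + int j + 2" using nn[of j] unfolding a_Suc by linarith
    show "int j \<le> a j"
    proof (induction j)
      case (Suc j)
      then show ?case using nn[of j] unfolding a_Suc by linarith
    qed (simp add: a0)
  qed
  have c_le: "c j \<le> - int j" and c_step: "c (Suc j) \<le> c j - int j - 2" for j
  proof -
    have nn: "0 \<le> (\<Sum>i\<le>j+1. \<bar>\<lfloor>inv (g i) (of_int (c j))\<rfloor>\<bar>)" for j by (rule sum_nonneg) simp
    show "c (Suc j) \<le> c j - int j - 2" using nn[of j] unfolding c_Suc by linarith
    show "c j \<le> - int j"
    proof (induction j)
      case (Suc j)
      then show ?case using nn[of j] unfolding c_Suc by linarith
    qed (simp add: c0)
  qed
  have a_sparse: "g i (of_int (a j)) < of_int (a (Suc j))" if "i \<le> j + 1" for i j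
  proof -
    have "\<bar>\<lceil>g i (of_int (a j))\<rceil>\<bar> \<le> (\<Sum>i\<le>j+1. \<bar>\<lceil>g i (of_int (a j))\<rceil>\<bar>)"
      using that by (intro member_le_sum) auto
    then have "\<lceil>g i (of_int (a j))\<rceil> < a (Suc j)"
      unfolding a_Suc using a_ge[of j] by linarith
    then show ?thesis by linarith
  qed
  have c_sparse: "g i (of_int (c (Suc j))) < of_int (c j)" if "i \<le> j + 1" for i j
  proof -
    have "\<bar>\<lfloor>inv (g i) (of_int (c j))\<rfloor>\<bar> \<le> (\<Sum>i\<le>j+1. \<bar>\<lfloor>inv (g i) (of_int (c j))\<rfloor>\<bar>)"
      using that by (intro member_le_sum) auto
    then have "c (Suc j) < \<lfloor>inv (g i) (of_int (c j))\<rfloor>"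
      unfolding c_Suc using c_le[of j] by linarith
    then have "of_int (c (Suc j)) < inv (g i) (of_int (c j))" by linarith
    then have "g i (of_int (c (Suc j))) < g i (inv (g i) (of_int (c j)))"
      by (simp only: autos_less_iff[OF g])
    then show ?thesis by (simp only: autos_f_inv[OF g])
  qed
  define \<sigma> :: "int \<Rightarrow> int" where "\<sigma> k = (if k \<ge> 0 then a (nat k) else c (nat (- k)))" for k
  have \<sigma>_step: "\<sigma> k < \<sigma> (k + 1)" for k
  proof (cases "k \<ge> 0")
    case True
    then have "nat (k + 1) = Suc (nat k)" by simp
    then show ?thesis using True a_step[of "nat k"] by (simp add: \<sigma>_def)
  next
    case False
    then have k: "nat (- k) = Suc (nat (- (k + 1)))" by simp
    have "\<sigma> (k + 1) = c (nat (- (k + 1)))" using False a0 c0 by (auto simp: \<sigma>_def)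
    then show ?thesis using False c_step[of "nat (- (k + 1))"] unfolding \<sigma>_def k by simp
  qed
  have \<sigma>_mono: "strict_mono \<sigma>" by (rule strict_mono_int_stepI) (rule \<sigma>_step)
  \<comment> \<open>The gap from \<open>k\<close> to \<open>k + 1\<close> is large for
    \<open>g i\<close> only if one of its ends is at distance at least \<open>i\<close> from zero,
    on the proper side.\<close>
  have \<sigma>_sparse: "g i (of_int (\<sigma> k)) < of_int (\<sigma> (k + 1))" if "int i \<le> k + 1 \<or> int i \<le> - k" for i k
  proof (cases "k \<ge> 0")
    case True
    then have k: "nat (k + 1) = Suc (nat k)" by simp
    have "i \<le> nat k + 1" using True that by linarith
    then show ?thesis using a_sparse[of i "nat k"] True by (simp add: \<sigma>_def k)
  next
    case False
    then have k: "nat (- k) = Suc (nat (- (k + 1)))" by simp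
    have "\<sigma> (k + 1) = c (nat (- (k + 1)))" using False a0 c0 by (auto simp: \<sigma>_def)
    moreover have "\<sigma> k = c (nat (- k))" using False by (simp add: \<sigma>_def)
    ultimately show ?thesis
      using c_sparse[of i "nat (- (k + 1))"] False that unfolding k by auto
  qed
  have \<sigma>_pos: "\<sigma> k \<ge> k + 1" if "k \<ge> 1" for k
  proof -
    have "nat k = Suc (nat (k - 1))" using that by simp
    then show ?thesis using a_step[of "nat (k - 1)"] a_ge[of "nat (k - 1)"] that
      by (simp add: \<sigma>_def)
  qed
  have \<sigma>_neg: "\<sigma> k \<le> k - 1" if "k \<le> -1" for k
  proof -
    have "nat (- k) = Suc (nat (- k - 1))" using that by simp
    then show ?thesis using c_step[of "nat (- k - 1)"] c_le[of "nat (- k - 1)"] that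
      by (simp add: \<sigma>_def)
  qed
  have pos: "(\<sigma> ^^ n) k \<ge> k + int n" if "k \<ge> 1" for n k
  proof (induction n)
    case (Suc n)
    then show ?case using \<sigma>_pos[of "(\<sigma> ^^ n) k"] that by simp
  qed simp
  have neg: "(\<sigma> ^^ n) k \<le> k - int n" if "k \<le> -1" for n k
  proof (induction n)
    case (Suc n)
    then show ?case using \<sigma>_neg[of "(\<sigma> ^^ n) k"] that by simp
  qed simp
  define s where "s = interpolate (of_int \<circ> \<sigma>)"
  have s: "s \<in> autos" unfolding s_def
  proof (rule interpolate_autos)
    fix k show "(of_int \<circ> \<sigma>) k < ((of_int \<circ> \<sigma>) (k + 1) :: rat)" using \<sigma>_step by simp
  next
    fix y :: rat
    have "\<sigma> (min (-1) \<lfloor>y\<rfloor>) \<le> \<lfloor>y\<rfloor>" using \<sigma>_neg[of "min (-1) \<lfloor>y\<rfloor>"] by linarith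
    then have "(of_int \<circ> \<sigma>) (min (-1) \<lfloor>y\<rfloor>) \<le> y" by (simp add: le_floor_iff)
    then show "\<exists>k. (of_int \<circ> \<sigma>) k \<le> y" ..
    have "\<lfloor>y\<rfloor> < \<sigma> (max 1 \<lfloor>y\<rfloor>)" using \<sigma>_pos[of "max 1 \<lfloor>y\<rfloor>"] by linarith
    then have "y < (of_int \<circ> \<sigma>) (max 1 \<lfloor>y\<rfloor>)" by (simp add: floor_less_iff)
    then show "\<exists>k. y < (of_int \<circ> \<sigma>) k" ..
  qed
  have s_pow: "(s ^^ n) (of_int k) = of_int ((\<sigma> ^^ n) k)" for n k
    by (induction n) (simp_all add: s_def)
  have "g n ((s ^^ Suc n) (of_int k)) < (s ^^ Suc n) (of_int (k + 1))" for n k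
  proof -
    define j where "j = (\<sigma> ^^ n) k"
    define j' where "j' = (\<sigma> ^^ n) (k + 1)"
    have "j < j'" unfolding j_def j'_def
      by (induction n) (simp_all add: strict_mono_less[OF \<sigma>_mono])
    have le: "\<sigma> i \<le> \<sigma> i'" if "i \<le> i'" for i i'
      using \<sigma>_mono that by (simp add: strict_mono_less_eq)
    have "g n (of_int (\<sigma> j)) < of_int (\<sigma> j')"
    \<comment> \<open>\<open>\<sigma>\<close> fixes 0, so the end of the interval away from zero
      must be used: the last gap before \<open>j'\<close> on the right, the first gap after
      \<open>j\<close> on the left.\<close>
    proof (cases "k \<ge> 0")
      case True
      then have "int n \<le> (j' - 1) + 1" using pos[of "k + 1" n] by (simp add: j'_def)
      then have "g n (of_int (\<sigma> (j' - 1))) < of_int (\<sigma> j')" using \<sigma>_sparse[of n "j' - 1"] by simp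
      moreover have "g n (of_int (\<sigma> j)) \<le> g n (of_int (\<sigma> (j' - 1)))"
        using le[of j "j' - 1"] \<open>j < j'\<close> by (simp add: autos_le_iff[OF g])
      ultimately show ?thesis by simp
    next
      case False
      then have "int n \<le> - j" using neg[of k n] by (simp add: j_def)
      then have "g n (of_int (\<sigma> j)) < of_int (\<sigma> (j + 1))" using \<sigma>_sparse[of n j] by simp
      also have "\<dots> \<le> of_int (\<sigma> j')" using le[of "j + 1" j'] \<open>j < j'\<close> by simp
      finally show ?thesis .
    qed
    then show ?thesis unfolding s_pow by (simp add: j_def j'_def)
  qed
  then show ?thesis using s by blast
qed

subsection \<open>Countable chains for the rationals are eventually constant\<close>

locale rat_autos_chain = autos_chain H for H :: "nat \<Rightarrow> (rat \<Rightarrow> rat) set"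
begin

text \<open>The diagonal argument selects one image of \<open>wide_blocks\<close> under
  \<open>t = u ^^ n\<close>. The commutator argument runs inside it with the inner shift conjugated
  by \<open>t\<close>, and conjugating back by \<open>t\<close> returns to
  \<open>even_blocks\<close>.\<close>

lemma even_blocks_H: "\<exists>k. supported_on even_blocks \<subseteq> H k"
proof -
  obtain b where b: "b \<in> supported_on wide_blocks"
      "\<And>i x. x \<in> even_blocks \<Longrightarrow> (b ^^ Suc i) x \<notin> even_blocks"
    using inner_shift by blast
  obtain u where u: "u \<in> autos" "\<And>i x. x \<in> wide_blocks \<Longrightarrow> (u ^^ Suc i) x \<notin> wide_blocks"
    using outer_shift by blast
  have less: "(u ^^ i) ` wide_blocks \<inter> (u ^^ j) ` wide_blocks = {}" if ij: "i < j" for i j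
  proof -
    obtain d where j: "j = i + Suc d" using less_imp_Suc_add[OF ij] by auto
    have "(u ^^ i) x \<noteq> (u ^^ j) y" if "x \<in> wide_blocks" "y \<in> wide_blocks" for x y
    proof
      assume "(u ^^ i) x = (u ^^ j) y"
      also have "(u ^^ j) y = (u ^^ i) ((u ^^ Suc d) y)"
        unfolding j by (simp only: funpow_add comp_apply)
      finally have "x = (u ^^ Suc d) y" using autos_eq_iff[OF autos_funpow[OF u(1)]] by blast
      then show False using u(2)[of y d] that by simp
    qed
    then show ?thesis by blast
  qed
  have "(u ^^ i) ` wide_blocks \<inter> (u ^^ j) ` wide_blocks = {}" if "i \<noteq> j" for i j
    using less[of i j] less[of j i] that by (cases "i < j") (auto simp: not_less Int_commute)
  then obtain n where n: "\<forall>g\<in>supported_on ((u ^^ n) ` wide_blocks).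
      \<exists>h\<in>H n. \<forall>x\<in>(u ^^ n) ` wide_blocks. h x = g x"
    using diagonal[of "\<lambda>n. (u ^^ n) ` wide_blocks"] by blast
  define t where "t = u ^^ n"
  have t: "t \<in> autos" using u by (simp add: t_def)
  have pow: "(conj_by t b ^^ i) (t x) = t ((b ^^ i) x)" for i x
    by (induction i) (simp_all add: conj_by_apply autos_inv_f[OF t])
  have "\<exists>k. supported_on (t ` even_blocks) \<subseteq> H k"
  proof (rule commutator[where n = n])
    show "conj_by t b \<in> supported_on (t ` wide_blocks)"
      using t b(1) by (rule conj_by_supported_on)
    have "even_blocks \<subseteq> wide_blocks"
    proof
      fix x assume "x \<in> even_blocks"
      then obtain q where "8 * of_int q \<le> x" "x < 8 * of_int q + 4"
        unfolding even_blocks_iff by blast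
      then have "8 * of_int q - 1 \<le> x \<and> x < 8 * of_int q + 5" by linarith
      then show "x \<in> wide_blocks" unfolding wide_blocks_def by blast
    qed
    then show "t ` even_blocks \<subseteq> t ` wide_blocks" by blast
    fix i x assume "x \<in> t ` even_blocks"
    then obtain y where y: "x = t y" "y \<in> even_blocks" by blast
    show "(conj_by t b ^^ Suc i) x \<notin> t ` even_blocks"
      unfolding y(1) pow using b(2)[OF y(2), of i] by (simp only: inj_image_mem_iff[OF bij_is_inj[OF autos_bij[OF t]]] not_False_eq_True)
  qed (use n in \<open>auto simp: t_def\<close>)
  then obtain k where "supported_on (t ` even_blocks) \<subseteq> H k" ..
  then obtain l where l: "\<And>g. conj_by t g \<in> supported_on (t ` even_blocks) \<Longrightarrow> g \<in> autos \<Longrightarrow> g \<in> H l"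
    using conj_subset_H[OF t] by blast
  have "supported_on even_blocks \<subseteq> H l"
    using l conj_by_supported_on[OF t] supported_on_autos by blast
  then show ?thesis ..
qed

text \<open>For \<open>a = 0\<close> split into even and odd blocks; translation by 4 turns odd
  blocks into even ones. Translation by \<open>- a\<close> reduces the general case to this
  one.\<close>

lemma fixing_H: "\<exists>k. fixing a \<subseteq> H k"
proof -
  obtain k1 where k1: "supported_on even_blocks \<subseteq> H k1" using even_blocks_H ..
  obtain k2 where k2: "\<And>g. conj_by (\<lambda>x. x + 4) g \<in> supported_on even_blocks \<Longrightarrow> g \<in> autos \<Longrightarrow> g \<in> H k2"
    using conj_subset_H[OF translation_autos k1] by blast
  have fix0: "fixing 0 \<subseteq> H (Suc (max k1 k2))"
  proof
    fix g assume "g \<in> fixing 0"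
    then obtain g1 g2 where g: "g1 \<in> supported_on even_blocks"
        "g2 \<in> supported_on (- even_blocks)" "g = g1 \<circ> g2"
      using fixing_factor by blast
    have "conj_by (\<lambda>x. x + 4) g2 x = x" if "x \<notin> even_blocks" for x
    proof -
      have "x / 4 = (x - 4) / 4 + of_int 1" by (simp add: diff_divide_distrib)
      then have "\<lfloor>x / 4\<rfloor> = \<lfloor>(x - 4) / 4\<rfloor> + 1" by (simp only: floor_add_int)
      then have "x - 4 \<notin> - even_blocks" using that by (simp add: even_blocks_def)
      then show ?thesis using supported_on_fixes[OF g(2)] by (simp add: conj_by_translation)
    qed
    then have "conj_by (\<lambda>x. x + 4) g2 \<in> supported_on even_blocks"
      using supported_on_autos[OF g(2)] translation_autos by (simp add: supported_on_def)
    then have "g2 \<in> H k2" using k2 supported_on_autos[OF g(2)] by blast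
    then show "g \<in> H (Suc (max k1 k2))"
      unfolding g(3) using g(1) k1 by (intro comp_H) (auto intro: H_le)
  qed
  obtain l where l: "\<And>g. conj_by (\<lambda>x. x + - a) g \<in> fixing 0 \<Longrightarrow> g \<in> autos \<Longrightarrow> g \<in> H l"
    using conj_subset_H[OF translation_autos fix0] by blast
  have "fixing a \<subseteq> H l"
  proof
    fix g assume g: "g \<in> fixing a"
    then have "conj_by (\<lambda>x. x + - a) g \<in> autos"
      by (intro autos_conj_by translation_autos) (simp add: fixing_def)
    moreover have "conj_by (\<lambda>x. x + - a) g (4 * of_int k + 0) = 4 * of_int k + 0" for k
      using g unfolding conj_by_translation by (simp add: fixing_def)
    ultimately have "conj_by (\<lambda>x. x + - a) g \<in> fixing 0" unfolding fixing_def by blast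
    then show "g \<in> H l" using l g by (auto simp: fixing_def)
  qed
  then show ?thesis ..
qed

lemma unit_displacement_H:
  "\<exists>k. \<forall>g\<in>autos. (\<forall>i. of_int i \<le> g (of_int i) \<and> g (of_int i) < of_int i + 1) \<longrightarrow> g \<in> H k"
proof -
  obtain k0 k2 where k: "fixing 0 \<subseteq> H k0" "fixing 2 \<subseteq> H k2" using fixing_H by metis
  have "g \<in> H (Suc (max k0 k2))"
    if disp: "g \<in> autos" "\<And>i. of_int i \<le> g (of_int i) \<and> g (of_int i) < of_int i + 1" for g
  proof -
    obtain p q where "p \<in> fixing 2" "q \<in> fixing 0" "g = p \<circ> q"
      using unit_displacement_factor[of g, OF disp] by blast
    then show ?thesis using k by (auto intro!: comp_H intro: H_le)
  qed
  then show ?thesis by blast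
qed

text \<open>Every \<open>f\<close> is \<open>f\<^sub>1 \<circ> f\<^sub>2\<^sup>-\<^sup>1\<close> with \<open>f\<^sub>1 = max f id\<close> and both factors above the identity.\<close>

lemma above_id_not_H:
  assumes "\<And>n. H n \<noteq> autos"
  shows "\<exists>g\<in>autos. (\<forall>x. x \<le> g x) \<and> g \<notin> H n"
proof (rule ccontr)
  assume "\<not> ?thesis"
  then have H: "g \<in> H n" if "g \<in> autos" "\<And>x. x \<le> g x" for g using that by blast
  have "f \<in> H (Suc n)" if f: "f \<in> autos" for f
  proof -
    define g where "g x = max (f x) x" for x
    have g: "g \<in> autos"
    proof (rule autosI)
      have "\<exists>x. g x = y" for y
      proof -
        have "f (inv f y) = y" using f by (rule autos_f_inv)
        moreover have "y \<le> inv f y \<longleftrightarrow> f y \<le> y"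
          using autos_le_iff[OF f, of y "inv f y"] calculation by simp
        \<comment> \<open>The inverse of the maximum of \<open>f\<close> and the identity is the
          minimum of \<open>inv f\<close> and the identity.\<close>
        ultimately have "g (min (inv f y) y) = y" by (auto simp: g_def min_def max_def)
        then show ?thesis ..
      qed
      then show "surj g" unfolding surj_def by metis
      show "strict_mono g"
        by (rule strict_monoI) (simp add: g_def max.strict_coboundedI1 max.strict_coboundedI2 autos_less_iff[OF f])
    qed
    have "x \<le> (inv f \<circ> g) x" for x
      using autos_le_iff[OF autos_inv[OF f], of "f x" "g x"] f by (simp add: g_def)
    then have "inv f \<circ> g \<in> H n" using f g by (intro H) auto
    then have "g \<circ> inv (inv f \<circ> g) \<in> H (Suc n)"
      using H[OF g] by (intro comp_H inv_H) (auto simp: g_def)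
    moreover have "g \<circ> inv (inv f \<circ> g) = f"
    proof
      fix x
      define y where "y = inv (inv f \<circ> g) x"
      have "(inv f \<circ> g) y = x" unfolding y_def using f g by (intro autos_f_inv autos_comp autos_inv)
      then have "f (inv f (g y)) = f x" by simp
      then show "(g \<circ> inv (inv f \<circ> g)) x = f x" by (simp add: autos_f_inv[OF f] y_def)
    qed
    ultimately show ?thesis by simp
  qed
  then have "H (Suc n) = autos" using H_autos by blast
  then show False using assms by blast
qed

lemma exists_H_eq_autos: "\<exists>n. H n = autos"
proof (rule ccontr)
  assume no: "\<nexists>n. H n = autos"
  then have "\<forall>n. \<exists>g\<in>autos. (\<forall>x. x \<le> g x) \<and> g \<notin> H (2 * n)"
    using above_id_not_H by blast
  then obtain g where g: "\<And>n. g n \<in> autos" "\<And>n x. x \<le> g n x" "\<And>n. g n \<notin> H (2 * n)"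
    by metis
  obtain s where s: "s \<in> autos"
      "\<And>n k. g n ((s ^^ Suc n) (of_int k)) < (s ^^ Suc n) (of_int (k + 1))"
    using sparse_iterates[of g, OF g(1)] by blast
  obtain K where K: "\<And>f. f \<in> autos \<Longrightarrow> (\<And>i. of_int i \<le> f (of_int i) \<and> f (of_int i) < of_int i + 1) \<Longrightarrow> f \<in> H K"
    using unit_displacement_H by blast
  obtain m where m: "s \<in> H m" using s(1) autos_H by blast
  \<comment> \<open>Large enough that \<open>K \<le> m + n\<close>, which puts \<open>f\<close> and
    \<open>t\<close> into the same member, and that \<open>m + n + 2 \<le> 2 * n\<close>.\<close>
  define n where "n = m + K + 2"
  define t where "t = s ^^ Suc n"
  have t: "t \<in> autos" using s(1) unfolding t_def by (rule autos_funpow)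
  have "t \<in> H (m + n)" unfolding t_def using m by (rule funpow_H)
  define f where "f = conj_by (inv t) (g n)"
  have f: "f x = inv t (g n (t x))" for x
    using t by (simp add: f_def conj_by_apply)
  have f_autos: "f \<in> autos" using t g(1) by (simp add: f_def)
  have "f \<in> H K"
  proof (rule K[OF f_autos])
    fix i
    \<comment> \<open>Applying \<open>t\<close> turns the displacement bound into a comparison of
      \<open>g n\<close> at \<open>t i\<close> with \<open>t i\<close> and \<open>t (i + 1)\<close>:
      the first is \<open>id \<le> g n\<close>, the second the sparseness of
      \<open>s\<close>.\<close>
    have tf: "t (f x) = g n (t x)" for x by (simp add: f autos_f_inv[OF t])
    have "t (of_int i) \<le> t (f (of_int i))" unfolding tf by (rule g(2))
    moreover have "t (f (of_int i)) < t (of_int (i + 1))"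
      unfolding tf unfolding t_def by (rule s(2))
    ultimately show "of_int i \<le> f (of_int i) \<and> f (of_int i) < of_int i + 1"
      by (simp add: autos_le_iff[OF t] autos_less_iff[OF t])
  qed
  then have "conj_by t f \<in> H (Suc (Suc (m + n)))"
    using \<open>t \<in> H (m + n)\<close> by (intro conj_by_H) (auto intro: H_le simp: n_def)
  moreover have "conj_by t f = g n"
    by (rule ext) (simp add: conj_by_apply f autos_f_inv[OF t])
  ultimately have "g n \<in> H (2 * n)" using H_le[of "g n" "Suc (Suc (m + n))" "2 * n"] by (simp add: n_def)
  then show False using g(3) by blast
qed

end

subsection \<open>Cofinalities and the Bergman property\<close>

lemma Aut_Q_simps:
  "f \<otimes>\<^bsub>Aut_Q\<^esub> g = f \<circ> g" "\<one>\<^bsub>Aut_Q\<^esub> = id"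
  by (simp_all add: Aut_Q_def)

lemma m_inv_Aut_Q: "f \<in> autos \<Longrightarrow> m_inv Aut_Q f = inv f"
  by (rule group.inv_equality[OF group_Aut_Q])
    (auto simp: Aut_Q_simps carrier_Aut_Q fun_eq_iff)

text \<open>A subsequence along which each product set is absorbed by the next member satisfies the
  normalized chain conditions. Both the bound on \<open>scf\<close> and the Bergman property reduce
  to this form.\<close>

lemma strong_chain_stabilizes:
  fixes K :: "nat \<Rightarrow> (rat \<Rightarrow> rat) set"
  assumes mono: "mono K" and Un: "(\<Union>n. K n) = carrier Aut_Q"
    and inv: "\<And>n. K n = set_inv\<^bsub>Aut_Q\<^esub> (K n)"
    and mult: "\<And>n. \<exists>m. K n <#>\<^bsub>Aut_Q\<^esub> K n \<subseteq> K m"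
  shows "\<exists>n. K n = carrier Aut_Q"
proof -
  obtain M where M: "\<And>n. K n <#>\<^bsub>Aut_Q\<^esub> K n \<subseteq> K (M n)" using mult by metis
  define \<phi> where "\<phi> = rec_nat 0 (\<lambda>_ k. max (Suc k) (M k))"
  have \<phi>_Suc: "\<phi> (Suc n) = max (Suc (\<phi> n)) (M (\<phi> n))" for n by (simp add: \<phi>_def)
  have \<phi>: "strict_mono \<phi>" by (simp add: strict_mono_Suc_iff \<phi>_Suc less_max_iff_disj)
  have K_le: "f \<in> K n" if "f \<in> K m" "m \<le> n" for f m n
    using monoD[OF mono that(2)] that(1) by blast
  interpret rat_autos_chain "\<lambda>n. K (\<phi> n)"
  proof
    show "mono (\<lambda>n. K (\<phi> n))"
      by (intro monoI monoD[OF mono]) (simp add: strict_mono_less_eq[OF \<phi>])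
    have K_autos: "K n \<subseteq> autos" for n using Un unfolding carrier_Aut_Q by blast
    have "K n \<subseteq> K (\<phi> n)" for n
      by (rule monoD[OF mono]) (rule strict_mono_imp_increasing[OF \<phi>])
    then have "(\<Union>n. K n) \<subseteq> (\<Union>n. K (\<phi> n))" by blast
    then show "(\<Union>n. K (\<phi> n)) = autos" using K_autos unfolding Un carrier_Aut_Q by blast
    fix f g n
    assume f: "f \<in> K (\<phi> n)"
    then have "inv f = m_inv Aut_Q f" using K_autos m_inv_Aut_Q by (metis subsetD)
    moreover have "m_inv Aut_Q f \<in> set_inv\<^bsub>Aut_Q\<^esub> (K (\<phi> n))" using f unfolding SET_INV_def by blast
    ultimately show "inv f \<in> K (\<phi> n)" using inv[of "\<phi> n"] by simp
    assume "g \<in> K (\<phi> n)"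
    with f have "f \<circ> g \<in> K (\<phi> n) <#>\<^bsub>Aut_Q\<^esub> K (\<phi> n)"
      unfolding set_mult_def Aut_Q_simps by blast
    then have "f \<circ> g \<in> K (M (\<phi> n))" using M by blast
    then show "f \<circ> g \<in> K (\<phi> (Suc n))" by (rule K_le) (simp add: \<phi>_Suc)
  qed
  show ?thesis using exists_H_eq_autos unfolding carrier_Aut_Q by blast
qed

lemma Well_order_cases:
  assumes "Well_order r" "i \<in> Field r" "j \<in> Field r"
  shows "(i, j) \<in> r \<or> (j, i) \<in> r"
proof (cases "i = j")
  case True
  then show ?thesis using assms by (simp add: order_on_defs refl_on_def)
next
  case False
  then show ?thesis using assms by (auto simp: order_on_defs total_on_def)
qed

text \<open>A witness of countable length would yield an increasing sequence of proper subsets that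
  is forbidden by \<open>strong_chain_stabilizes\<close>.\<close>

lemma scf_witness_Aut_Q_uncountable:
  assumes r: "Card_order r" and w: "scf_witness Aut_Q r"
  shows "natLeq <o r"
proof (rule ccontr)
  assume "\<not> natLeq <o r"
  moreover have wo: "Well_order r" using r by (rule card_order_on_well_order_on)
  ultimately have "r \<le>o natLeq"
    using not_ordLess_iff_ordLeq[OF wo natLeq_Well_order] by blast
  then have "|Field r| \<le>o natLeq" using card_of_Field_ordIso[OF r] ordIso_ordLeq_trans by blast
  then have "|Field r| \<le>o |UNIV :: nat set|"
    using card_of_nat ordIso_symmetric ordLeq_ordIso_trans by blast
  then obtain f :: "_ \<Rightarrow> nat" where f: "inj_on f (Field r)"
    unfolding card_of_ordLeq[symmetric] by blast
  obtain H where chain: "chain_union Aut_Q r H"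
    and H: "\<forall>i\<in>Field r. H i \<subset> carrier Aut_Q \<and> H i = set_inv\<^bsub>Aut_Q\<^esub> (H i) \<and>
        (\<exists>j\<in>Field r. (i, j) \<in> r \<and> H i <#>\<^bsub>Aut_Q\<^esub> H i \<subseteq> H j)"
    using w unfolding scf_witness_def by (elim exE conjE)
  have H_mono: "H i \<subseteq> H j" if "(i, j) \<in> r" for i j
    using chain that by (simp add: chain_union_def)
  have H_Un: "(\<Union>i\<in>Field r. H i) = carrier Aut_Q"
    using chain by (simp add: chain_union_def)
  have "carrier Aut_Q \<noteq> {}" using autos_id unfolding carrier_Aut_Q by blast
  then obtain i0 where i0: "i0 \<in> Field r" using H_Un by blast
  \<comment> \<open>A left inverse of \<open>f\<close>; the default \<open>i0\<close> keeps
    \<open>e n\<close> in \<open>Field r\<close> when \<open>n\<close> is not a value of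
    \<open>f\<close>.\<close>
  define e where "e n = (if n \<in> f ` Field r then inv_into (Field r) f n else i0)" for n
  have e_Field: "e n \<in> Field r" for n using i0 by (simp add: e_def inv_into_into)
  have e_f: "e (f i) = i" if "i \<in> Field r" for i
    using that f by (simp add: e_def)
  have linear: "H i \<subseteq> H j \<or> H j \<subseteq> H i" if "i \<in> Field r" "j \<in> Field r" for i j
    using Well_order_cases[OF wo that] H_mono by blast
  \<comment> \<open>Finite unions of members of a chain are members again, so this is an increasing
    sequence through the chain. It works for finite and for infinite countable \<open>r\<close>
    alike.\<close>
  define K where "K n = (\<Union>i\<le>n. H (e i))" for n
  have K_H: "\<exists>m\<in>Field r. K n = H m" for n
  proof (induction n)
    case 0
    then show ?case using e_Field by (auto simp: K_def)
  next
    case (Suc n)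
    then obtain m where m: "m \<in> Field r" "K n = H m" by blast
    have "K (Suc n) = H m \<union> H (e (Suc n))" unfolding m(2)[symmetric]
      by (simp add: K_def atMost_Suc Un_commute)
    then show ?case using linear[OF m(1) e_Field[of "Suc n"]] m(1) e_Field[of "Suc n"]
      by (metis sup.absorb1 sup.absorb2)
  qed
  have H_K: "H i \<subseteq> K (f i)" if "i \<in> Field r" for i
    unfolding K_def using e_f[OF that] by (metis UN_upper atMost_iff order_refl)
  have "\<exists>n. K n = carrier Aut_Q"
  proof (rule strong_chain_stabilizes)
    show "mono K" unfolding K_def by (intro monoI UN_mono) auto
    show "(\<Union>n. K n) = carrier Aut_Q"
    proof (rule antisym)
      have "K n \<subseteq> (\<Union>i\<in>Field r. H i)" for n using K_H[of n] by blast
      then show "(\<Union>n. K n) \<subseteq> carrier Aut_Q" unfolding H_Un by blast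
      have "(\<Union>i\<in>Field r. H i) \<subseteq> (\<Union>n. K n)" using H_K by blast
      then show "carrier Aut_Q \<subseteq> (\<Union>n. K n)" unfolding H_Un .
    qed
    fix n
    obtain m where m: "m \<in> Field r" "K n = H m" using K_H by blast
    show "K n = set_inv\<^bsub>Aut_Q\<^esub> (K n)" unfolding m(2) using bspec[OF H m(1)] by (elim conjE)
    show "\<exists>m. K n <#>\<^bsub>Aut_Q\<^esub> K n \<subseteq> K m"
    proof -
      obtain j where "j \<in> Field r" "H m <#>\<^bsub>Aut_Q\<^esub> H m \<subseteq> H j"
        using bspec[OF H m(1)] by (elim conjE bexE)
      then have "K n <#>\<^bsub>Aut_Q\<^esub> K n \<subseteq> K (f j)" unfolding m(2) using H_K[of j] by simp
      then show ?thesis ..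
    qed
  qed
  then obtain n where "K n = carrier Aut_Q" ..
  moreover obtain m where m: "m \<in> Field r" "K n = H m" using K_H by blast
  ultimately show False using bspec[OF H m(1)] by simp
qed

section \<open>Powers of a symmetric set, and chains of subgroups\<close>

context group
begin

lemma set_power_closed: "X \<subseteq> carrier G \<Longrightarrow> set_power G X n \<subseteq> carrier G"
  by (induction n) (auto simp: set_mult_def)

lemma set_power_mult:
  assumes X: "X \<subseteq> carrier G" and f: "f \<in> set_power G X m" and g: "g \<in> set_power G X n"
  shows "f \<otimes> g \<in> set_power G X (m + n)"
  using g
proof (induction n arbitrary: g)
  case 0
  have "f \<in> carrier G" using set_power_closed[OF X] f by blast
  then show ?case using 0 f by simp
next
  case (Suc n)
  then obtain h x where h: "h \<in> set_power G X n" "x \<in> X" "g = h \<otimes> x"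
    by (auto simp: set_mult_def)
  then have "f \<otimes> g = (f \<otimes> h) \<otimes> x"
    using X f set_power_closed[OF X] by (metis m_assoc subsetD)
  then show ?case using Suc.IH[OF h(1)] h(2) by (auto simp: set_mult_def)
qed

lemma set_power_1:
  assumes "X \<subseteq> carrier G"
  shows "set_power G X 1 = X"
proof -
  have "set_power G X 1 = (\<lambda>x. \<one> \<otimes> x) ` X" by (auto simp: set_mult_def)
  also have "\<dots> = id ` X" by (rule image_cong) (use assms in auto)
  finally show ?thesis by simp
qed

lemma set_power_inv:
  assumes X: "X \<subseteq> carrier G" "X = set_inv X" and f: "f \<in> set_power G X n"
  shows "m_inv G f \<in> set_power G X n"
  using f
proof (induction n arbitrary: f)
  case (Suc n)
  then obtain h x where h: "h \<in> set_power G X n" "x \<in> X" "f = h \<otimes> x"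
    by (auto simp: set_mult_def)
  then have "m_inv G f = m_inv G x \<otimes> m_inv G h"
    using X(1) set_power_closed[OF X(1)] by (metis inv_mult_group subsetD)
  moreover have "m_inv G x \<in> set_power G X 1"
    unfolding set_power_1[OF X(1)] using X(2) h(2) unfolding SET_INV_def by blast
  ultimately show ?case using set_power_mult[OF X(1), of "m_inv G x" 1 "m_inv G h" n] Suc.IH[OF h(1)] by simp
qed simp

lemma set_power_mono:
  assumes X: "X \<subseteq> carrier G" "\<one> \<in> X"
  shows "mono (set_power G X)"
proof (rule mono_iff_le_Suc[THEN iffD2], intro allI subsetI)
  fix n f assume "f \<in> set_power G X n"
  then have "f = f \<otimes> \<one>" "f \<in> set_power G X n" using set_power_closed[OF X(1)] by (auto simp: subset_iff)
  then show "f \<in> set_power G X (Suc n)" using X(2) by (auto simp: set_mult_def)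
qed

lemma generate_eq_Union_set_power:
  assumes X: "X \<subseteq> carrier G" "X = set_inv X"
  shows "generate G X = (\<Union>n. set_power G X n)"
proof
  show "generate G X \<subseteq> (\<Union>n. set_power G X n)"
  proof
    fix f assume "f \<in> generate G X"
    then show "f \<in> (\<Union>n. set_power G X n)"
    proof induction
      case one
      have "\<one> \<in> set_power G X 0" by simp
      then show ?case by blast
    next
      case (incl h)
      then show ?case using set_power_1[OF X(1)] by blast
    next
      case (inv h)
      then have "m_inv G h \<in> set_power G X 1"
        unfolding set_power_1[OF X(1)] using X(2) unfolding SET_INV_def by blast
      then show ?case by blast
    next
      case (eng h1 h2)
      then show ?case using set_power_mult[OF X(1)] by blast
    qed
  qed
  have "set_power G X n \<subseteq> generate G X" for n
    by (induction n) (auto simp: set_mult_def intro: generate.intros)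
  then show "(\<Union>n. set_power G X n) \<subseteq> generate G X" by blast
qed

text \<open>A subgroup is symmetric and closed under products, so \<open>j = i\<close> serves in the
  product condition. Lower bounds for strong witnesses therefore apply to chains of
  subgroups.\<close>

lemma cf_witness_imp_scf_witness:
  assumes "Well_order r" "cf_witness G r"
  shows "scf_witness G r"
proof -
  obtain H where H: "chain_union G r H" "\<And>i. i \<in> Field r \<Longrightarrow> subgroup (H i) G \<and> H i \<noteq> carrier G"
    using assms(2) unfolding cf_witness_def by blast
  have "H i \<subset> carrier G \<and> H i = set_inv (H i) \<and>
      (\<exists>j\<in>Field r. (i, j) \<in> r \<and> H i <#> H i \<subseteq> H j)" if i: "i \<in> Field r" for i
  proof (intro conjI)
    have sub: "subgroup (H i) G" using H(2)[OF i] by blast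
    show "H i \<subset> carrier G" using H(2)[OF i] subgroup.subset by blast
    show "H i = set_inv (H i)"
    proof
      show "H i \<subseteq> set_inv (H i)"
      proof
        fix x assume x: "x \<in> H i"
        then have "x = m_inv G (m_inv G x)" using subgroup.mem_carrier[OF sub] by simp
        then show "x \<in> set_inv (H i)"
          using subgroup.m_inv_closed[OF sub x] unfolding SET_INV_def by blast
      qed
      show "set_inv (H i) \<subseteq> H i"
        using subgroup.m_inv_closed[OF sub] unfolding SET_INV_def by blast
    qed
    have "(i, i) \<in> r" using Well_order_cases[OF assms(1) i i] by blast
    moreover have "H i <#> H i \<subseteq> H i"
      using subgroup.m_closed[OF sub] unfolding set_mult_def by blast
    ultimately show "\<exists>j\<in>Field r. (i, j) \<in> r \<and> H i <#> H i \<subseteq> H j" using i by blast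
  qed
  then show ?thesis using H(1) unfolding scf_witness_def by blast
qed

text \<open>
  Index the chain by a generating set \<open>A\<close> of minimal cardinality: fewer elements than \<open>|A|\<close>
  never generate.
\<close>

lemma exists_cf_witness:
  assumes inf: "\<And>A. finite A \<Longrightarrow> A \<subseteq> carrier G \<Longrightarrow> generate G A \<noteq> carrier G"
  shows "\<exists>r :: 'a rel. Card_order r \<and> cf_witness G r"
proof -
  define \<R> :: "'a rel set" where "\<R> = {|A| | A. A \<subseteq> carrier G \<and> generate G A = carrier G}"
  have "generate G (carrier G) = carrier G"
    using generate_incl[of "carrier G"] generate.incl[of _ "carrier G" G] by blast
  then have "\<R> \<noteq> {}" unfolding \<R>_def by blast
  moreover have "\<forall>r\<in>\<R>. Card_order r" unfolding \<R>_def using card_of_Card_order by blast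
  ultimately obtain r where "r \<in> \<R>" and least: "\<And>r'. r' \<in> \<R> \<Longrightarrow> r \<le>o r'"
    using exists_minim_Card_order[of \<R>] by blast
  then obtain A where A: "r = |A|" "A \<subseteq> carrier G" "generate G A = carrier G"
    unfolding \<R>_def by blast
  have r: "Card_order r" unfolding A(1) by (rule card_of_Card_order)
  have Field: "Field r = A" unfolding A(1) by (rule Field_card_of)
  have infinite: "infinite (Field r)" unfolding Field using inf A by blast
  have wo: "Well_order r" using r by (rule card_order_on_well_order_on)
  have underS_A: "underS r i \<subseteq> A" for i using Field by (auto simp: underS_def Field_def)
  define H where "H i = generate G (underS r i)" for i
  have mono: "H i \<subseteq> H j" if "(i, j) \<in> r" for i j
    unfolding H_def using wo that by (intro mono_generate underS_incr) (auto simp: order_on_defs)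
  have sub: "subgroup (H i) G" for i
    unfolding H_def using underS_A A(2) by (intro generate_is_subgroup) blast
  have proper: "H i \<noteq> carrier G" if "i \<in> Field r" for i
  proof
    assume "H i = carrier G"
    then have "|underS r i| \<in> \<R>" unfolding \<R>_def H_def using underS_A A(2) by blast
    then have "r \<le>o |underS r i|" by (rule least)
    then show False using card_of_underS[OF r that] not_ordLess_ordLeq by blast
  qed
  have "\<exists>i\<in>Field r. x \<in> H i" if "x \<in> generate G A" for x
    using that
  proof induction
    case one
    obtain i where "i \<in> Field r" using infinite by (metis finite.emptyI ex_in_conv)
    then show ?case using subgroup.one_closed[OF sub] by blast
  next
    case (incl h)
    \<comment> \<open>An infinite cardinal has no last element, so \<open>h\<close> lies strictly
      below some \<open>j\<close> and is one of the generators of \<open>H j\<close>.\<close>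
    then obtain j where "j \<in> Field r" "h \<noteq> j" "(h, j) \<in> r"
      using infinite_Card_order_limit[OF r infinite] Field by blast
    then show ?case unfolding H_def using generate.incl[of h "underS r j"]
      by (auto simp: underS_def)
  next
    case (inv h)
    then obtain j where "j \<in> Field r" "h \<noteq> j" "(h, j) \<in> r"
      using infinite_Card_order_limit[OF r infinite] Field by blast
    then show ?case unfolding H_def using generate.inv[of h "underS r j"]
      by (auto simp: underS_def)
  next
    case (eng h1 h2)
    then obtain i j where ij: "i \<in> Field r" "h1 \<in> H i" "j \<in> Field r" "h2 \<in> H j" by blast
    have "(i, j) \<in> r \<or> (j, i) \<in> r"
      using wo ij(1,3) by (rule Well_order_cases)
    then obtain k where "k \<in> Field r" "h1 \<in> H k" "h2 \<in> H k" using ij mono by blast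
    then show ?case using subgroup.m_closed[OF sub] by blast
  qed
  then have "carrier G \<subseteq> (\<Union>i\<in>Field r. H i)" unfolding A(3) by blast
  moreover have "(\<Union>i\<in>Field r. H i) \<subseteq> carrier G" by (intro UN_least subgroup.subset sub)
  ultimately have "chain_union G r H"
    unfolding chain_union_def using mono by (intro conjI allI impI antisym)
  then have "cf_witness G r"
    unfolding cf_witness_def using sub proper by (intro exI[of _ H] conjI ballI)
  then show ?thesis using r by (intro exI[of _ r] conjI)
qed

end

text \<open>The powers of \<open>X\<close> increase because \<open>X\<close> contains the identity,
  are symmetric, satisfy that the product of the \<open>n\<close>-th power with itself lies in the
  \<open>2n\<close>-th, and exhaust the group because \<open>X\<close> generates. So one of them is
  the whole group.\<close>

lemma Bergman_property_Aut_Q: "Bergman_property Aut_Q"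
  unfolding Bergman_property_def
proof (intro allI impI, elim conjE)
  interpret group Aut_Q by (rule group_Aut_Q)
  fix X assume X: "X \<subseteq> carrier Aut_Q" "generate Aut_Q X = carrier Aut_Q"
    "X = set_inv\<^bsub>Aut_Q\<^esub> X" "\<one>\<^bsub>Aut_Q\<^esub> \<in> X"
  have "\<exists>n. set_power Aut_Q X n = carrier Aut_Q"
  proof (rule strong_chain_stabilizes)
    show "mono (set_power Aut_Q X)" using X(1,4) by (rule set_power_mono)
    show "(\<Union>n. set_power Aut_Q X n) = carrier Aut_Q"
      using generate_eq_Union_set_power[OF X(1,3)] X(2) by simp
    fix n
    have inv: "m_inv Aut_Q f \<in> set_power Aut_Q X n" if "f \<in> set_power Aut_Q X n" for f
      using X(1,3) that by (rule set_power_inv)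
    show "set_power Aut_Q X n = set_inv\<^bsub>Aut_Q\<^esub> (set_power Aut_Q X n)"
    proof
      show "set_power Aut_Q X n \<subseteq> set_inv\<^bsub>Aut_Q\<^esub> (set_power Aut_Q X n)"
      proof
        fix f assume f: "f \<in> set_power Aut_Q X n"
        then have "f = m_inv Aut_Q (m_inv Aut_Q f)"
          using set_power_closed[OF X(1)] by (auto simp: subset_iff)
        then show "f \<in> set_inv\<^bsub>Aut_Q\<^esub> (set_power Aut_Q X n)"
          using inv[OF f] unfolding SET_INV_def by blast
      qed
      show "set_inv\<^bsub>Aut_Q\<^esub> (set_power Aut_Q X n) \<subseteq> set_power Aut_Q X n"
        using inv unfolding SET_INV_def by blast
    qed
    show "\<exists>m. set_power Aut_Q X n <#>\<^bsub>Aut_Q\<^esub> set_power Aut_Q X n \<subseteq> set_power Aut_Q X m"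
      using set_power_mult[OF X(1), of _ n _ n] unfolding set_mult_def by blast
  qed
  then show "\<exists>N. carrier Aut_Q = set_power Aut_Q X N" by metis
qed

text \<open>After adding inverses and the identity, the Bergman property would make the group a
  power of a finite set, hence finite; but there are infinitely many translations.\<close>

lemma Aut_Q_not_finitely_generated:
  assumes "finite A" "A \<subseteq> carrier Aut_Q"
  shows "generate Aut_Q A \<noteq> carrier Aut_Q"
proof
  interpret group Aut_Q by (rule group_Aut_Q)
  assume gen: "generate Aut_Q A = carrier Aut_Q"
  define X where "X = A \<union> m_inv Aut_Q ` A \<union> {\<one>\<^bsub>Aut_Q\<^esub>}"
  have X: "X \<subseteq> carrier Aut_Q" using assms(2) by (auto simp: X_def)
  have "generate Aut_Q A \<subseteq> generate Aut_Q X" by (rule mono_generate) (auto simp: X_def)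
  then have "generate Aut_Q X = carrier Aut_Q" using gen generate_incl[OF X] by blast
  moreover have "X = set_inv\<^bsub>Aut_Q\<^esub> X"
  proof -
    have "set_inv\<^bsub>Aut_Q\<^esub> X = m_inv Aut_Q ` X" by (auto simp: SET_INV_def)
    also have "\<dots> = m_inv Aut_Q ` A \<union> (\<lambda>f. m_inv Aut_Q (m_inv Aut_Q f)) ` A \<union> {\<one>\<^bsub>Aut_Q\<^esub>}"
      by (simp add: X_def image_Un image_image)
    also have "(\<lambda>f. m_inv Aut_Q (m_inv Aut_Q f)) ` A = A"
      using assms(2) by (force simp: subset_iff)
    finally show ?thesis by (auto simp: X_def)
  qed
  ultimately obtain N where N: "carrier Aut_Q = set_power Aut_Q X N"
    using Bergman_property_Aut_Q X unfolding Bergman_property_def X_def by blast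
  have "finite X" using assms(1) by (simp add: X_def)
  then have "finite (set_power Aut_Q X n)" for n
    by (induction n) (auto simp: set_mult_def)
  then have "finite (carrier Aut_Q)" using N by metis
  moreover have "range (\<lambda>a x. x + a) \<subseteq> carrier Aut_Q"
    using translation_autos unfolding carrier_Aut_Q by blast
  moreover have "inj (\<lambda>(a::rat) x. x + a)"
    by (rule injI) (metis add_left_cancel)
  ultimately have "finite (UNIV :: rat set)" by (metis finite_subset finite_imageD)
  then show False using infinite_UNIV_char_0 by blast
qed

text \<open>Cardinals are well-ordered, so a least one exists as soon as some cardinal has the
  property; the choice in \<open>least_cardinal\<close> is then meaningful.\<close>

lemma least_cardinal_sat:
  assumes "Card_order r" "P r"
  shows "Card_order (least_cardinal P) \<and> P (least_cardinal P)"
proof -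
  have "\<exists>r\<in>{r. Card_order r \<and> P r}. \<forall>r'\<in>{r. Card_order r \<and> P r}. r \<le>o r'"
    by (rule exists_minim_Card_order) (use assms in auto)
  then have "\<exists>r. Card_order r \<and> P r \<and> (\<forall>r'. Card_order r' \<and> P r' \<longrightarrow> r \<le>o r')" by blast
  from someI_ex[OF this] show ?thesis unfolding least_cardinal_def by blast
qed

theorem corollary1p8:
  shows "natLeq <o scf Aut_Q \<and> natLeq <o cf Aut_Q \<and> Bergman_property Aut_Q"
proof (intro conjI)
  interpret group Aut_Q by (rule group_Aut_Q)
  have scf_of_cf: "scf_witness Aut_Q r" if "Card_order r" "cf_witness Aut_Q r" for r :: "(rat \<Rightarrow> rat) rel"
    using card_order_on_well_order_on[OF that(1)] that(2) by (rule cf_witness_imp_scf_witness)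
  \<comment> \<open>Some witness must exist before \<open>cf\<close> and \<open>scf\<close> are
    determined; a chain of subgroups provides one for both.\<close>
  obtain r :: "(rat \<Rightarrow> rat) rel" where r: "Card_order r" "cf_witness Aut_Q r"
    using exists_cf_witness Aut_Q_not_finitely_generated by blast
  have "Card_order (cf Aut_Q) \<and> cf_witness Aut_Q (cf Aut_Q)"
    unfolding cf_def using r by (rule least_cardinal_sat)
  then show "natLeq <o cf Aut_Q"
    using scf_of_cf scf_witness_Aut_Q_uncountable by blast
  have "Card_order (scf Aut_Q) \<and> scf_witness Aut_Q (scf Aut_Q)"
    unfolding scf_def using r(1) scf_of_cf[OF r] by (rule least_cardinal_sat)
  then show "natLeq <o scf Aut_Q"
    using scf_witness_Aut_Q_uncountable by blast
qed (rule Bergman_property_Aut_Q)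

end
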